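(* Let $B(u)$ be the generating matrix of the reflection algebra $\mathcal B(n,l)$. For each $\eta=(\eta_1,\dots,\eta_n)\in I_n$ define permutations $p_\eta^{[i]}\in S_n$, $i=1,\dots,n$, recursively by $$p_\eta^{[n]}:=\mathrm{Id},\qquad p_\eta^{[i]}:=p_\eta^{[i+1]}\,\bigl(i,\,(p_\eta^{[i+1]})^{-1}(\eta_i)\bigr)\quad\text{for } i=n-1,n-2,\dots,1,$$ and put $p_\eta:=p_\eta^{[1]}$. Then $$\langle\langle B_1,\dots,B_n\rangle\rangle=\sum_{\eta\in I_n}\alpha(\eta)\,p_\eta^{-1}\,B_{\eta_1}(u)\,B_{\eta_2}(u-1)\cdots B_{\eta_n}(u-n+1),$$ where $p_\eta^{-1}\in S_n$ is identified with the corresponding operator acting on $(\mathbb C^n)^{\otimes n}$.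
   Context: Reflection algebra. Let $n=m+l$ with $m,l$ nonnegative integers, and $\varepsilon_i=1$ for $1\le i\le m$, $\varepsilon_i=-1$ for $m<i\le n$. Let $P:v\otimes w\mapsto w\otimes v$ on $\mathbb C^n\otimes\mathbb C^n$ and $R(u)=1-P/u$. The reflection algebra $\mathcal B(n,l)$ is the unital associative algebra over $\mathbb C$ with generators $b_{ij}^{(r)}$ ($i,j=1,\dots,n$, $r=0,1,2,\dots$), $b_{ij}^{(0)}=\delta_{ij}\varepsilon_i$, collected into series $b_i^j(u)=\sum_{r\ge0}b_{ij}^{(r)}u^{-r}$ and the matrix $B(u)=\sum_{i,j}E_{ij}\otimes b_i^j(u)\in\operatorname{End}\mathbb C^n\otimes\mathcal B(n,l)[[u^{-1}]]$, subject to the reflection equation $R(u-v)B_1(u)R(u+v)B_2(v)=B_2(v)R(u+v)B_1(u)R(u-v)$ and the unitary condition $B(u)B(-u)=1$. For a matrix $X=(x_{ij})$ over an associative algebra $A$, $X_s=\sum_{i,j}1\otimes\cdots\otimes E_{ij}\otimes\cdots\otimes1\otimes x_{ij}\in\operatorname{End}(\mathbb C^n)^{\otimes n}\otimes A$ with $E_{ij}$ in the $s$-th position; $P_{ij}$ denotes $P$ acting on the $i$-th and $j$-th copies of $\mathbb C^n$ in $(\mathbb C^n)^{\otimes n}$. The symmetric group $S_n$ acts on $(\mathbb C^n)^{\otimes n}$ by permuting tensor factors, the transposition $(i,j)$ acting as $P_{ij}$ (a product of transpositions acts as the product of the corresponding operators in the same order); $(k,k)$ denotes the identity permutation. Products of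 permutations are composed from right to left. Shifted series and rational functions of $u$ are expanded as power series in $u^{-1}$. For $k=1,\dots,n$ put $\Pi_k=1-(2u-k-n+2)^{-1}\sum_{i=k+1}^nP_{ki}$, and $$\langle\langle B_1,\dots,B_n\rangle\rangle=B_1(u)\Pi_1B_2(u-1)\Pi_2\cdots B_{n-1}(u-n+2)\Pi_{n-1}B_n(u-n+1).$$ $I_n\subset\mathbb Z^n$ is the set of $n$-tuples $\eta=(\eta_1,\dots,\eta_n)$ with $i\le\eta_i\le n$ for all $i=1,\dots,n$, and $\alpha(\eta)=\prod_{i:\,i<\eta_i}\frac{1}{n-2u-2+i}$. *)

theory Defs
  imports
    "HOL-Algebra.Algebra"
    "HOL-Algebra.Algebraic_Closure_Type"
    "HOL-Computational_Algebra.Formal_Laurent_Series"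
    "HOL-Library.Poly_Mapping"
    "HOL-Combinatorics.Permutations"
begin

section \<open>Free algebras over the complex numbers\<close>

datatype 'g monomial = Monomial (letters: "'g list")

instantiation monomial :: (type) monoid_add
begin

definition zero_monomial :: "'a monomial" where
  "0 = Monomial []"

definition plus_monomial :: "'a monomial \<Rightarrow> 'a monomial \<Rightarrow> 'a monomial" where
  "v + w = Monomial (letters v @ letters w)"

instance
  by standard (simp_all add: zero_monomial_def plus_monomial_def)

end

text \<open>
  Finitely supported functions on noncommutative monomials form, with the convolution product
  of \<^theory>\<open>HOL-Library.Poly_Mapping\<close>, the free unital associative algebra on the type
  \<^typ>\<open>'g\<close>. The carrier below restricts to the polynomials in the generators from \<open>S\<close>.
\<close>

type_synonym 'g free_poly = "'g monomial \<Rightarrow>\<^sub>0 complex"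

definition free_algebra :: "'g set \<Rightarrow> 'g free_poly ring" where
  "free_algebra S =
     ring_of_type_algebra \<lparr>carrier := {p. \<forall>w \<in> Poly_Mapping.keys p. set (letters w) \<subseteq> S}\<rparr>"

definition const :: "complex \<Rightarrow> 'g free_poly" where
  "const c = Poly_Mapping.single 0 c"

definition gen :: "'g \<Rightarrow> 'g free_poly" where
  "gen g = Poly_Mapping.single (Monomial [g]) 1"


section \<open>Matrices and power series over a ring\<close>

definition matrix_ring :: "'i set \<Rightarrow> ('a, 'b) ring_scheme \<Rightarrow> ('i \<times> 'i \<Rightarrow> 'a) ring" where
  "matrix_ring I R = \<lparr>
     carrier = I \<times> I \<rightarrow>\<^sub>E carrier R,
     monoid.mult = (\<lambda>M N. \<lambda>(i, k) \<in> I \<times> I. \<Oplus>\<^bsub>R\<^esub>j\<in>I. M (i, j) \<otimes>\<^bsub>R\<^esub> N (j, k)),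
     one = (\<lambda>(i, j) \<in> I \<times> I. if i = j then \<one>\<^bsub>R\<^esub> else \<zero>\<^bsub>R\<^esub>),
     ring.zero = (\<lambda>_ \<in> I \<times> I. \<zero>\<^bsub>R\<^esub>),
     add = (\<lambda>M N. \<lambda>ij \<in> I \<times> I. M ij \<oplus>\<^bsub>R\<^esub> N ij)\<rparr>"

definition matrix_scale ::
  "'i set \<Rightarrow> ('a, 'b) ring_scheme \<Rightarrow> 'a \<Rightarrow> ('i \<times> 'i \<Rightarrow> 'a) \<Rightarrow> 'i \<times> 'i \<Rightarrow> 'a" where
  "matrix_scale I R f M = (\<lambda>ij \<in> I \<times> I. f \<otimes>\<^bsub>R\<^esub> M ij)"

text \<open>
  The ring of formal power series in \<open>u\<^sup>-\<^sup>1\<close> over a not necessarily commutative ring; \<open>f r\<close> is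
  the coefficient of \<open>u\<^sup>-\<^sup>r\<close>.
\<close>

definition series_ring :: "('a, 'b) ring_scheme \<Rightarrow> (nat \<Rightarrow> 'a) ring" where
  "series_ring R = \<lparr>
     carrier = UNIV \<rightarrow> carrier R,
     monoid.mult = (\<lambda>f g r. \<Oplus>\<^bsub>R\<^esub>s\<in>{..r}. f s \<otimes>\<^bsub>R\<^esub> g (r - s)),
     one = (\<lambda>r. if r = 0 then \<one>\<^bsub>R\<^esub> else \<zero>\<^bsub>R\<^esub>),
     ring.zero = (\<lambda>r. \<zero>\<^bsub>R\<^esub>),
     add = (\<lambda>f g r. f r \<oplus>\<^bsub>R\<^esub> g r)\<rparr>"

definition ordered_prod :: "('a, 'b) monoid_scheme \<Rightarrow> ('i \<Rightarrow> 'a) \<Rightarrow> 'i list \<Rightarrow> 'a" where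
  "ordered_prod G f xs = foldr (\<lambda>i x. f i \<otimes>\<^bsub>G\<^esub> x) xs \<one>\<^bsub>G\<^esub>"


section \<open>The reflection algebra\<close>

text \<open>
  Here \<open>n = m + l\<close>, and the letter \<open>(i, j, r)\<close> stands for the generator \<open>b\<^sub>i\<^sub>j\<^sup>(\<^sup>r\<^sup>)\<close>.
\<close>

type_synonym refl_poly = "(nat \<times> nat \<times> nat) free_poly"

definition refl_free_algebra :: "nat \<Rightarrow> nat \<Rightarrow> refl_poly ring" where
  "refl_free_algebra m l = free_algebra ({1..m + l} \<times> {1..m + l} \<times> UNIV)"

definition eps :: "nat \<Rightarrow> nat \<Rightarrow> complex" where
  "eps m i = (if i \<le> m then 1 else -1)"

definition zeroth_relators :: "nat \<Rightarrow> nat \<Rightarrow> refl_poly set" where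
  "zeroth_relators m l =
     {gen (i, j, 0) - const (if i = j then eps m i else 0) | i j. i \<in> {1..m + l} \<and> j \<in> {1..m + l}}"

text \<open>
  The reflection equation is read in power series in \<open>u\<^sup>-\<^sup>1\<close> whose coefficients are Laurent
  series in \<open>v\<^sup>-\<^sup>1\<close>. In \<^typ>\<open>refl_poly fls fps\<close> the variable \<^const>\<open>fps_X\<close> is
  \<open>u\<^sup>-\<^sup>1\<close>, and in \<^typ>\<open>refl_poly fls\<close> the element \<^const>\<open>fls_X_inv\<close> is \<open>v\<close>.
  \<open>inv_u_minus w\<close> is the expansion of \<open>(u - w)\<^sup>-\<^sup>1\<close> as the sum of \<open>w\<^sup>k u\<^sup>-\<^sup>k\<^sup>-\<^sup>1\<close> over \<open>k \<ge> 0\<close>.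
\<close>

definition inv_u_minus :: "'a::ring_1 \<Rightarrow> 'a fps" where
  "inv_u_minus w = fps_X * Abs_fps (\<lambda>k. w ^ k)"

text \<open>\<open>R_minus\<close> is \<open>R(u - v) = 1 - P / (u - v)\<close> and \<open>R_plus\<close> is \<open>R(u + v) = 1 - P / (u + v)\<close>.\<close>

definition R_minus :: "nat \<Rightarrow> (nat \<times> nat) \<times> (nat \<times> nat) \<Rightarrow> refl_poly fls fps" where
  "R_minus n = (\<lambda>(a, c) \<in> ({1..n} \<times> {1..n}) \<times> ({1..n} \<times> {1..n}).
     (if a = c then 1 else 0) - (if a = prod.swap c then inv_u_minus fls_X_inv else 0))"

definition R_plus :: "nat \<Rightarrow> (nat \<times> nat) \<times> (nat \<times> nat) \<Rightarrow> refl_poly fls fps" where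
  "R_plus n = (\<lambda>(a, c) \<in> ({1..n} \<times> {1..n}) \<times> ({1..n} \<times> {1..n}).
     (if a = c then 1 else 0) - (if a = prod.swap c then inv_u_minus (- fls_X_inv) else 0))"

definition B1_u :: "nat \<Rightarrow> (nat \<times> nat) \<times> (nat \<times> nat) \<Rightarrow> refl_poly fls fps" where
  "B1_u n = (\<lambda>(a, c) \<in> ({1..n} \<times> {1..n}) \<times> ({1..n} \<times> {1..n}).
     if snd a = snd c then Abs_fps (\<lambda>r. fls_const (gen (fst a, fst c, r))) else 0)"

definition B2_v :: "nat \<Rightarrow> (nat \<times> nat) \<times> (nat \<times> nat) \<Rightarrow> refl_poly fls fps" where
  "B2_v n = (\<lambda>(a, c) \<in> ({1..n} \<times> {1..n}) \<times> ({1..n} \<times> {1..n}).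
     if fst a = fst c
     then fps_const (fps_to_fls (Abs_fps (\<lambda>r. gen (snd a, snd c, r)))) else 0)"

definition reflection_relators :: "nat \<Rightarrow> refl_poly set" where
  "reflection_relators n =
     (let I = {1..n} \<times> {1..n};
          M = matrix_ring I (ring_of_type_algebra :: refl_poly fls fps ring);
          L = R_minus n \<otimes>\<^bsub>M\<^esub> B1_u n \<otimes>\<^bsub>M\<^esub> R_plus n \<otimes>\<^bsub>M\<^esub> B2_v n;
          L' = B2_v n \<otimes>\<^bsub>M\<^esub> R_plus n \<otimes>\<^bsub>M\<^esub> B1_u n \<otimes>\<^bsub>M\<^esub> R_minus n
      in {fls_nth (fps_nth (L x - L' x) r) s | x r s. x \<in> I \<times> I})"

text \<open>In the unitary condition \<^const>\<open>fps_X\<close> is again \<open>u\<^sup>-\<^sup>1\<close>.\<close>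

definition B_u :: "nat \<Rightarrow> nat \<times> nat \<Rightarrow> refl_poly fps" where
  "B_u n = (\<lambda>(i, j) \<in> {1..n} \<times> {1..n}. Abs_fps (\<lambda>r. gen (i, j, r)))"

definition B_minus_u :: "nat \<Rightarrow> nat \<times> nat \<Rightarrow> refl_poly fps" where
  "B_minus_u n = (\<lambda>(i, j) \<in> {1..n} \<times> {1..n}. Abs_fps (\<lambda>r. (-1) ^ r * gen (i, j, r)))"

definition unitary_relators :: "nat \<Rightarrow> refl_poly set" where
  "unitary_relators n =
     (let I = {1..n};
          M = matrix_ring I (ring_of_type_algebra :: refl_poly fps ring);
          L = B_u n \<otimes>\<^bsub>M\<^esub> B_minus_u n
      in {fps_nth (L x - \<one>\<^bsub>M\<^esub> x) r | x r. x \<in> I \<times> I})"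

definition refl_ideal :: "nat \<Rightarrow> nat \<Rightarrow> refl_poly set" where
  "refl_ideal m l = Idl\<^bsub>refl_free_algebra m l\<^esub>
     (zeroth_relators m l \<union> reflection_relators (m + l) \<union> unitary_relators (m + l))"

text \<open>\<open>reflection_algebra m l\<close> is \<open>\<B>(m + l, l)\<close>.\<close>

definition reflection_algebra :: "nat \<Rightarrow> nat \<Rightarrow> refl_poly set ring" where
  "reflection_algebra m l = refl_free_algebra m l Quot refl_ideal m l"

definition refl_class :: "nat \<Rightarrow> nat \<Rightarrow> refl_poly \<Rightarrow> refl_poly set" where
  "refl_class m l p = refl_ideal m l +>\<^bsub>refl_free_algebra m l\<^esub> p"


section \<open>Series and tensor operators over the reflection algebra\<close>

abbreviation refl_series :: "nat \<Rightarrow> nat \<Rightarrow> (nat \<Rightarrow> refl_poly set) ring" where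
  "refl_series m l \<equiv> series_ring (reflection_algebra m l)"

text \<open>
  Scalar rational functions of \<open>u\<close> live in the field \<^typ>\<open>complex fls\<close> of Laurent series in
  \<open>u\<^sup>-\<^sup>1\<close>, so that \<open>u\<close> itself is \<^const>\<open>fls_X_inv\<close>. \<open>scalar_series\<close> is only
  applied to elements without positive powers of \<open>u\<close>.
\<close>

abbreviation (input) uvar :: "complex fls" where
  "uvar \<equiv> fls_X_inv"

definition scalar_series :: "nat \<Rightarrow> nat \<Rightarrow> complex fls \<Rightarrow> nat \<Rightarrow> refl_poly set" where
  "scalar_series m l f = (\<lambda>k. refl_class m l (const (fls_nth f (int k))))"

text \<open>
  \<open>b_shift m l c (i, j)\<close> is \<open>b\<^sub>i\<^sup>j(u - c)\<close>, the sum of \<open>b\<^sub>i\<^sub>j\<^sup>(\<^sup>r\<^sup>) (u - c)\<^sup>-\<^sup>r\<close> over \<open>r\<close>, expanded in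
  \<open>u\<^sup>-\<^sup>1\<close>; only \<open>r \<le> k\<close> contribute to the coefficient of \<open>u\<^sup>-\<^sup>k\<close>.
\<close>

definition b_shift :: "nat \<Rightarrow> nat \<Rightarrow> complex \<Rightarrow> nat \<times> nat \<Rightarrow> nat \<Rightarrow> refl_poly set" where
  "b_shift m l c = (\<lambda>(i, j) k. \<Oplus>\<^bsub>reflection_algebra m l\<^esub>r\<in>{..k}.
     scalar_series m l (inverse (uvar - fls_const c) ^ r) k
       \<otimes>\<^bsub>reflection_algebra m l\<^esub> refl_class m l (gen (i, j, r)))"

text \<open>
  The basis vector \<open>e\<^bsub>a 1\<^esub> \<otimes> \<dots> \<otimes> e\<^bsub>a n\<^esub>\<close> of the \<open>n\<close>-fold tensor power of \<open>\<complex>\<^sup>n\<close> is indexed by the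
  function \<open>a\<close>; elements of \<open>End(\<complex>\<^sup>n)\<^sup>\<otimes>\<^sup>n \<otimes> A\<close> are matrices over \<open>A\<close> indexed by such functions.
\<close>

abbreviation tuples :: "nat \<Rightarrow> (nat \<Rightarrow> nat) set" where
  "tuples n \<equiv> {1..n} \<rightarrow>\<^sub>E {1..n}"

abbreviation tensor_ring ::
  "nat \<Rightarrow> ('a, 'b) ring_scheme \<Rightarrow> ((nat \<Rightarrow> nat) \<times> (nat \<Rightarrow> nat) \<Rightarrow> 'a) ring" where
  "tensor_ring n R \<equiv> matrix_ring (tuples n) R"

text \<open>\<open>in_position n R s M\<close> is \<open>M\<^sub>s\<close>.\<close>

definition in_position :: "nat \<Rightarrow> ('a, 'b) ring_scheme \<Rightarrow> nat \<Rightarrow> (nat \<times> nat \<Rightarrow> 'a) \<Rightarrow>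
    (nat \<Rightarrow> nat) \<times> (nat \<Rightarrow> nat) \<Rightarrow> 'a" where
  "in_position n R s M = (\<lambda>(a, c) \<in> tuples n \<times> tuples n.
     if \<forall>t \<in> {1..n} - {s}. a t = c t then M (a s, c s) else \<zero>\<^bsub>R\<^esub>)"

definition P_op :: "nat \<Rightarrow> ('a, 'b) ring_scheme \<Rightarrow> nat \<Rightarrow> nat \<Rightarrow>
    (nat \<Rightarrow> nat) \<times> (nat \<Rightarrow> nat) \<Rightarrow> 'a" where
  "P_op n R i j = (\<lambda>(a, c) \<in> tuples n \<times> tuples n.
     if a i = c j \<and> a j = c i \<and> (\<forall>t \<in> {1..n} - {i, j}. a t = c t) then \<one>\<^bsub>R\<^esub> else \<zero>\<^bsub>R\<^esub>)"

text \<open>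
  The operator of a permutation \<open>\<sigma>\<close> moves the tensor factor in position \<open>t\<close> to position \<open>\<sigma> t\<close>, so
  composition of permutations (from right to left) corresponds to composition of operators.
\<close>

definition perm_op :: "nat \<Rightarrow> ('a, 'b) ring_scheme \<Rightarrow> (nat \<Rightarrow> nat) \<Rightarrow>
    (nat \<Rightarrow> nat) \<times> (nat \<Rightarrow> nat) \<Rightarrow> 'a" where
  "perm_op n R \<sigma> = (\<lambda>(a, c) \<in> tuples n \<times> tuples n.
     if \<forall>t \<in> {1..n}. a (\<sigma> t) = c t then \<one>\<^bsub>R\<^esub> else \<zero>\<^bsub>R\<^esub>)"

abbreviation refl_tensor ::
  "nat \<Rightarrow> nat \<Rightarrow> ((nat \<Rightarrow> nat) \<times> (nat \<Rightarrow> nat) \<Rightarrow> nat \<Rightarrow> refl_poly set) ring" where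
  "refl_tensor m l \<equiv> tensor_ring (m + l) (refl_series m l)"

definition refl_scale :: "nat \<Rightarrow> nat \<Rightarrow> complex fls \<Rightarrow>
    ((nat \<Rightarrow> nat) \<times> (nat \<Rightarrow> nat) \<Rightarrow> nat \<Rightarrow> refl_poly set) \<Rightarrow>
    (nat \<Rightarrow> nat) \<times> (nat \<Rightarrow> nat) \<Rightarrow> nat \<Rightarrow> refl_poly set" where
  "refl_scale m l f M =
     matrix_scale (tuples (m + l)) (refl_series m l) (scalar_series m l f) M"

text \<open>\<open>B_op m l s c\<close> is \<open>B\<^sub>s(u - c)\<close>.\<close>

definition B_op :: "nat \<Rightarrow> nat \<Rightarrow> nat \<Rightarrow> complex \<Rightarrow>
    (nat \<Rightarrow> nat) \<times> (nat \<Rightarrow> nat) \<Rightarrow> nat \<Rightarrow> refl_poly set" where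
  "B_op m l s c = in_position (m + l) (refl_series m l) s (b_shift m l c)"

definition Pi_op :: "nat \<Rightarrow> nat \<Rightarrow> nat \<Rightarrow>
    (nat \<Rightarrow> nat) \<times> (nat \<Rightarrow> nat) \<Rightarrow> nat \<Rightarrow> refl_poly set" where
  "Pi_op m l k = \<one>\<^bsub>refl_tensor m l\<^esub> \<ominus>\<^bsub>refl_tensor m l\<^esub>
     refl_scale m l (inverse (2 * uvar - of_nat k - of_nat (m + l) + 2))
       (\<Oplus>\<^bsub>refl_tensor m l\<^esub>i\<in>{k + 1..m + l}. P_op (m + l) (refl_series m l) k i)"

text \<open>
  \<open>B\<^sub>1(u) \<Pi>\<^sub>1 B\<^sub>2(u - 1) \<Pi>\<^sub>2 \<dots> \<Pi>\<^bsub>n-1\<^esub> B\<^sub>n(u - n + 1)\<close>, with no operator \<open>\<Pi>\<^sub>n\<close> after the last factor.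
\<close>

definition double_bracket :: "nat \<Rightarrow> nat \<Rightarrow>
    (nat \<Rightarrow> nat) \<times> (nat \<Rightarrow> nat) \<Rightarrow> nat \<Rightarrow> refl_poly set" where
  "double_bracket m l = ordered_prod (refl_tensor m l)
     (\<lambda>k. B_op m l k (of_nat k - 1) \<otimes>\<^bsub>refl_tensor m l\<^esub>
            (if k < m + l then Pi_op m l k else \<one>\<^bsub>refl_tensor m l\<^esub>))
     [1..<m + l + 1]"


section \<open>The tuples \<open>\<eta>\<close>\<close>

definition eta_tuples :: "nat \<Rightarrow> (nat \<Rightarrow> nat) set" where
  "eta_tuples n = (\<Pi>\<^sub>E i\<in>{1..n}. {i..n})"

definition alpha :: "nat \<Rightarrow> (nat \<Rightarrow> nat) \<Rightarrow> complex fls" where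
  "alpha n \<eta> = (\<Prod>i | i \<in> {1..n} \<and> i < \<eta> i. 1 / (of_nat n - 2 * uvar - 2 + of_nat i))"

function p_eta :: "nat \<Rightarrow> (nat \<Rightarrow> nat) \<Rightarrow> nat \<Rightarrow> nat \<Rightarrow> nat" where
  "p_eta n \<eta> i =
     (if i \<ge> n then id
      else p_eta n \<eta> (Suc i) \<circ> Transposition.transpose i (inv_into UNIV (p_eta n \<eta> (Suc i)) (\<eta> i)))"
  by pat_completeness auto
termination
  by (relation "measure (\<lambda>(n, \<eta>, i). n - i)") auto

declare p_eta.simps [simp del]


section \<open>Well-definedness\<close>

lemma free_algebra_closed:
  fixes S :: "'g set"
  defines "C \<equiv> carrier (free_algebra S)"
  shows "0 \<in> C" "1 \<in> C" "p \<in> C \<Longrightarrow> q \<in> C \<Longrightarrow> p + q \<in> C" "p \<in> C \<Longrightarrow> - p \<in> C"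
    "p \<in> C \<Longrightarrow> q \<in> C \<Longrightarrow> p - q \<in> C" "p \<in> C \<Longrightarrow> q \<in> C \<Longrightarrow> p * q \<in> C"
    "const c \<in> C" "g \<in> S \<Longrightarrow> gen g \<in> C"
proof -
  have C: "p \<in> C \<longleftrightarrow> (\<forall>w \<in> Poly_Mapping.keys p. set (letters w) \<subseteq> S)" for p
    by (simp add: C_def free_algebra_def)
  show "0 \<in> C" "1 \<in> C"
    by (auto simp: C zero_monomial_def simp flip: single_one split: if_splits)
  show "p \<in> C \<Longrightarrow> q \<in> C \<Longrightarrow> p + q \<in> C" for p q
    unfolding C using Poly_Mapping.keys_add[of p q] by blast
  show "p \<in> C \<Longrightarrow> - p \<in> C" for p
    by (simp add: C keys_minus)
  show "p \<in> C \<Longrightarrow> q \<in> C \<Longrightarrow> p - q \<in> C" for p q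
    unfolding C using keys_diff[of p q] by blast
  show "p \<in> C \<Longrightarrow> q \<in> C \<Longrightarrow> p * q \<in> C" for p q
    unfolding C using keys_mult[of p q] by (fastforce simp: plus_monomial_def)
  show "const c \<in> C" "g \<in> S \<Longrightarrow> gen g \<in> C"
    by (auto simp: C const_def gen_def zero_monomial_def split: if_splits)
qed

lemma ring_free_algebra: "ring (free_algebra S)"
proof -
  note cl = free_algebra_closed[where S=S]
  have [simp]: "add (free_algebra S) = (+)" "monoid.mult (free_algebra S) = (*)"
    "ring.zero (free_algebra S) = 0" "one (free_algebra S) = 1"
    by (auto simp: free_algebra_def ring_of_type_algebra_def)
  have "\<exists>y \<in> carrier (free_algebra S). y + x = 0" if "x \<in> carrier (free_algebra S)" for x
    using cl(4)[OF that] by (intro bexI[of _ "- x"]) auto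
  then show ?thesis
    by (intro ringI abelian_groupI monoidI) (auto simp: cl algebra_simps)
qed

lemma finsum_type_algebra:
  "finsum (ring_of_type_algebra :: 'a::ring_1 ring) f A = sum f A"
proof -
  interpret abelian_monoid "ring_of_type_algebra :: 'a ring"
    by (intro abelian_monoidI) (auto simp: ring_of_type_algebra_def algebra_simps)
  show ?thesis
  proof (induction A rule: infinite_finite_induct)
    case (insert x F)
    have "f \<in> F \<rightarrow> carrier (ring_of_type_algebra :: 'a ring)"
      "f x \<in> carrier (ring_of_type_algebra :: 'a ring)"
      by (auto simp: ring_of_type_algebra_def)
    from finsum_insert[OF insert(1,2) this] insert show ?case
      by (simp add: ring_of_type_algebra_def)
  qed (simp_all add: finsum_infinite, simp_all add: ring_of_type_algebra_def)
qed

lemma refl_relators_in_carrier: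
  "zeroth_relators m l \<union> reflection_relators (m + l) \<union> unitary_relators (m + l)
     \<subseteq> carrier (refl_free_algebra m l)"
proof -
  define n where "n = m + l"
  define C where "C = carrier (refl_free_algebra m l)"
  note cl = free_algebra_closed[where S="{1..m + l} \<times> {1..m + l} \<times> (UNIV :: nat set)", 
      folded refl_free_algebra_def, folded C_def]
  have sumC: "sum f A \<in> C" if "\<And>x. x \<in> A \<Longrightarrow> f x \<in> C" for f :: "'b \<Rightarrow> refl_poly" and A
    using that by (induction A rule: infinite_finite_induct) (auto simp: cl)
  have genC: "gen (i, j, r) \<in> C" if "i \<in> {1..n}" "j \<in> {1..n}" for i j r
    using that by (auto intro!: cl simp: n_def)
  have z: "zeroth_relators m l \<subseteq> C"
    by (auto simp: zeroth_relators_def intro!: cl)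
  define L where "L = {f :: refl_poly fls. \<forall>s. fls_nth f s \<in> C}"
  have L: "0 \<in> L" "1 \<in> L" "f + g \<in> L" "f - g \<in> L" "f * g \<in> L" if "f \<in> L" "g \<in> L" for f g
    using that unfolding L_def by (auto simp: cl fls_times_nth(2) intro!: sumC)
  have L01: "0 \<in> L" "1 \<in> L" unfolding L_def by (auto simp: cl)
  have sumL: "sum f A \<in> L" if "\<And>x. x \<in> A \<Longrightarrow> f x \<in> L" for f :: "'b \<Rightarrow> refl_poly fls" and A
    using that by (induction A rule: infinite_finite_induct) (auto simp: L L01)
  have XL: "fls_X_inv \<in> L" "- fls_X_inv \<in> L"
    unfolding L_def by (auto simp: cl)
  have powL: "f ^ k \<in> L" if "f \<in> L" for f k
    using that by (induction k) (auto simp: L L01)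
  define Q where "Q = {F :: refl_poly fls fps. \<forall>r. fps_nth F r \<in> L}"
  have Q: "F + G \<in> Q" "F - G \<in> Q" "F * G \<in> Q" if "F \<in> Q" "G \<in> Q" for F G
    using that unfolding Q_def by (auto simp: L fps_mult_nth intro!: sumL)
  have Q01: "0 \<in> Q" "1 \<in> Q" unfolding Q_def by (auto simp: L01)
  have sumQ: "sum f A \<in> Q" if "\<And>x. x \<in> A \<Longrightarrow> f x \<in> Q" for f :: "'b \<Rightarrow> refl_poly fls fps" and A
    using that by (induction A rule: infinite_finite_induct) (auto simp: Q Q01)
  have invQ: "inv_u_minus w \<in> Q" if "w \<in> L" for w
    using that unfolding inv_u_minus_def
    by (intro Q) (auto simp: Q_def fps_X_def L01 powL)
  define I where "I = {1..n} \<times> {1..n}"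
  define MM where "MM = matrix_ring I (ring_of_type_algebra :: refl_poly fls fps ring)"
  have multQ: "(F \<otimes>\<^bsub>MM\<^esub> G) x \<in> Q" if "\<forall>x\<in>I\<times>I. F x \<in> Q" "\<forall>x\<in>I\<times>I. G x \<in> Q" "x \<in> I \<times> I" for F G x
    using that by (auto simp: MM_def matrix_ring_def finsum_type_algebra intro!: sumQ)
       (auto simp: ring_of_type_algebra_def Q)
  have ifQ: "(if b then F else G) \<in> Q" if "F \<in> Q" "G \<in> Q" for b F G
    using that by simp
  have e: "R_minus n x \<in> Q" "R_plus n x \<in> Q" if "x \<in> I \<times> I" for x
  proof -
    obtain a c where x: "x = (a, c)" by (cases x)
    show "R_minus n x \<in> Q" "R_plus n x \<in> Q"
      using that unfolding R_minus_def R_plus_def I_def[symmetric] x restrict_def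
      by (simp_all only: case_prod_conv if_True) (intro Q(2) ifQ invQ XL Q01)+
  qed
  have b: "B1_u n x \<in> Q" "B2_v n x \<in> Q" if "x \<in> I \<times> I" for x
  proof -
    obtain i j i' j' where x: "x = ((i, j), (i', j'))" by (cases x) auto
    have ij: "i \<in> {1..n}" "j \<in> {1..n}" "i' \<in> {1..n}" "j' \<in> {1..n}"
      using that by (auto simp: I_def x)
    have "Abs_fps (\<lambda>r. fls_const (gen (i, i', r))) \<in> Q"
      "fps_const (fps_to_fls (Abs_fps (\<lambda>r. gen (j, j', r)))) \<in> Q"
      using genC ij by (simp_all add: Q_def L_def cl)
    then show "B1_u n x \<in> Q" "B2_v n x \<in> Q"
      using that unfolding B1_u_def B2_v_def I_def[symmetric] x restrict_def
      by (simp_all only: case_prod_conv if_True fst_conv snd_conv) (intro ifQ Q01, assumption)+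
  qed
  have QC: "fls_nth (fps_nth F r) s \<in> C" if "F \<in> Q" for F r s
    using that by (auto simp: Q_def L_def)
  have r: "reflection_relators n \<subseteq> C"
  proof
    fix p assume "p \<in> reflection_relators n"
    then obtain x r s where x: "x \<in> I \<times> I" and p: "p = fls_nth (fps_nth
        ((R_minus n \<otimes>\<^bsub>MM\<^esub> B1_u n \<otimes>\<^bsub>MM\<^esub> R_plus n \<otimes>\<^bsub>MM\<^esub> B2_v n) x
         - (B2_v n \<otimes>\<^bsub>MM\<^esub> R_plus n \<otimes>\<^bsub>MM\<^esub> B1_u n \<otimes>\<^bsub>MM\<^esub> R_minus n) x) r) s"
      unfolding reflection_relators_def Let_def I_def[symmetric] MM_def[symmetric] by blast
    show "p \<in> C"
      unfolding p by (intro QC Q(2) multQ ballI x e b)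
  qed
  define U where "U = {F :: refl_poly fps. \<forall>r. fps_nth F r \<in> C}"
  have U: "F - G \<in> U" "F * G \<in> U" if "F \<in> U" "G \<in> U" for F G
    using that unfolding U_def by (auto simp: cl fps_mult_nth intro!: sumC)
  have U01: "0 \<in> U" "1 \<in> U" unfolding U_def by (auto simp: cl)
  have sumU: "sum f A \<in> U" if "\<And>x. x \<in> A \<Longrightarrow> f x \<in> U" for f :: "'b \<Rightarrow> refl_poly fps" and A
    using that unfolding U_def by (auto simp: fps_sum_nth intro!: sumC)
  define J where "J = {1..n}"
  define NN where "NN = matrix_ring J (ring_of_type_algebra :: refl_poly fps ring)"
  have multU: "(F \<otimes>\<^bsub>NN\<^esub> G) x \<in> U" if "\<forall>x\<in>J\<times>J. F x \<in> U" "\<forall>x\<in>J\<times>J. G x \<in> U" "x \<in> J \<times> J" for F G x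
    using that by (auto simp: NN_def matrix_ring_def finsum_type_algebra intro!: sumU)
       (auto simp: ring_of_type_algebra_def U)
  have sgn: "(-1) ^ r \<in> C" for r
    by (induction r) (auto simp: cl)
  have f: "\<forall>x\<in>J\<times>J. B_u n x \<in> U" "\<forall>x\<in>J\<times>J. B_minus_u n x \<in> U"
    using genC by (auto simp: B_u_def B_minus_u_def U_def J_def cl sgn)
  have oneU: "\<one>\<^bsub>NN\<^esub> x \<in> U" if "x \<in> J \<times> J" for x
    using that by (auto simp: NN_def matrix_ring_def) (auto simp: ring_of_type_algebra_def U01)
  have UC: "fps_nth F r \<in> C" if "F \<in> U" for F r
    using that by (auto simp: U_def)
  have u: "unitary_relators n \<subseteq> C"
  proof
    fix p assume "p \<in> unitary_relators n"
    then obtain x r where x: "x \<in> J \<times> J"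
      and p: "p = fps_nth ((B_u n \<otimes>\<^bsub>NN\<^esub> B_minus_u n) x - \<one>\<^bsub>NN\<^esub> x) r"
      unfolding unitary_relators_def Let_def J_def[symmetric] NN_def[symmetric] by blast
    show "p \<in> C"
      unfolding p by (intro UC U(1) multU oneU x f)
  qed
  show ?thesis
    using z r u by (simp add: C_def n_def)
qed

lemma ring_reflection_algebra: "ring (reflection_algebra m l)"
proof -
  interpret ring "refl_free_algebra m l"
    unfolding refl_free_algebra_def by (rule ring_free_algebra)
  show ?thesis
    unfolding reflection_algebra_def refl_ideal_def
    by (intro ideal.quotient_is_ring genideal_ideal refl_relators_in_carrier)
qed

lemma inv_u_minus: "(1 - fps_const w * fps_X) * inv_u_minus w = fps_X"
proof (rule fps_ext)
  fix k show "fps_nth ((1 - fps_const w * fps_X) * inv_u_minus w) k = fps_nth fps_X k"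
  proof (cases k)
    case (Suc j)
    then show ?thesis
      by (cases j) (simp_all add: inv_u_minus_def left_diff_distrib mult.assoc)
  qed (simp add: inv_u_minus_def left_diff_distrib mult.assoc)
qed

lemma P_op_eq_perm_op:
  assumes "i \<in> {1..n}" "j \<in> {1..n}"
  shows "P_op n R i j = perm_op n R (Transposition.transpose i j)"
proof -
  have "(a i = c j \<and> a j = c i \<and> (\<forall>t \<in> {1..n} - {i, j}. a t = c t)) \<longleftrightarrow>
        (\<forall>t \<in> {1..n}. a (Transposition.transpose i j t) = c t)" for a c :: "nat \<Rightarrow> nat"
    using assms by (auto simp: Transposition.transpose_def)
  then show ?thesis
    by (simp add: P_op_def perm_op_def)
qed

lemma p_eta_permutes:
  assumes "\<eta> \<in> eta_tuples n" "i \<in> {1..n}"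
  shows "p_eta n \<eta> i permutes {i..n}"
  using assms(2)
proof (induction "n - i" arbitrary: i)
  case 0
  then show ?case by (auto simp: p_eta.simps permutes_def)
next
  case (Suc d)
  let ?q = "p_eta n \<eta> (Suc i)"
  from Suc have "?q permutes {Suc i..n}" by simp
  then have q: "?q permutes {i..n}"
    by (rule permutes_subset) auto
  moreover have "\<eta> i \<in> {i..n}"
    using assms(1) Suc.prems by (auto simp: eta_tuples_def)
  ultimately have "Transposition.transpose i (inv_into UNIV ?q (\<eta> i)) permutes {i..n}"
    using Suc.prems by (intro permutes_swap_id) (auto simp only: permutes_in_image permutes_inv, auto)
  with q show ?case
    using Suc.hyps(2) by (simp add: p_eta.simps[of n \<eta> i] permutes_compose)
qed

end

theory Submission
  imports Defs "Jordan_Normal_Form.Missing_Ring"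
begin

text \<open>
  Scalars are central, and a permutation operator conjugates \<open>B\<^sub>s\<close> to \<open>B\<close> in the permuted position.
  Expanding every \<open>\<Pi>\<^sub>k\<close> gives the terms \<open>B\<^sub>1 t\<^sub>1 B\<^sub>2 t\<^sub>2 \<dots> t\<^bsub>n-1\<^esub> B\<^sub>n\<close> with \<open>t\<^sub>k = (k, j\<^sub>k)\<close> and
  \<open>k \<le> j\<^sub>k \<le> n\<close>. Put \<open>q\<^sub>k = t\<^bsub>n-1\<^esub> \<dots> t\<^sub>k\<close>. Moving the transpositions to the left turns \<open>B\<^sub>k\<close> into \<open>B\<close> in
  position \<open>\<eta>\<^sub>k = q\<^sub>k k = q\<^bsub>k+1\<^esub> j\<^sub>k\<close> and leaves the inverse of \<open>q\<^sub>1\<close> in front, while the \<open>q\<^sub>k\<close> satisfy the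
  recursion of \<open>p_eta\<close>. For fixed later entries the passage from \<open>j\<^sub>k\<close> to \<open>\<eta>\<^sub>k\<close> is a bijection of
  \<open>{k..n}\<close> fixing \<open>k\<close>, so the scalar factors match as well.
\<close>

section \<open>Matrix and power series rings\<close>

text \<open>The set of pairs is the disjoint union of its fibres over \<open>A\<close>. Needed for
  Cauchy products, where the range of the inner index depends on the outer one.\<close>

lemma (in abelian_monoid) finsum_Sigma:
  assumes "finite A" "\<And>a. a \<in> A \<Longrightarrow> finite (B a)"
    and "\<And>a b. a \<in> A \<Longrightarrow> b \<in> B a \<Longrightarrow> f a b \<in> carrier G"
  shows "(\<Oplus>a\<in>A. \<Oplus>b\<in>B a. f a b) = finsum G (\<lambda>(a, b). f a b) (Sigma A B)"
proof -
  have "Sigma A B = (\<Union>a\<in>A. Pair a ` B a)"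
    by auto
  then have "finsum G (\<lambda>(a, b). f a b) (Sigma A B) =
    finsum G (\<lambda>(a, b). f a b) (\<Union>a\<in>A. Pair a ` B a)"
    by simp
  also have "\<dots> = (\<Oplus>a\<in>A. finsum G (\<lambda>(a, b). f a b) (Pair a ` B a))"
    by (rule add.finprod_UN_disjoint) (use assms in \<open>auto simp: pairwise_def disjnt_def\<close>)
  also have "\<dots> = (\<Oplus>a\<in>A. \<Oplus>b\<in>B a. f a b)"
    using assms by (intro finsum_cong') (auto simp: finsum_reindex inj_on_def Pi_iff)
  finally show ?thesis ..
qed

section \<open>Matrices over a ring\<close>

lemma matrix_ring_simps:
  "carrier (matrix_ring I R) = I \<times> I \<rightarrow>\<^sub>E carrier R"
  "M \<otimes>\<^bsub>matrix_ring I R\<^esub> N = (\<lambda>(i, k) \<in> I \<times> I. \<Oplus>\<^bsub>R\<^esub>j\<in>I. M (i, j) \<otimes>\<^bsub>R\<^esub> N (j, k))"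
  "\<one>\<^bsub>matrix_ring I R\<^esub> = (\<lambda>(i, j) \<in> I \<times> I. if i = j then \<one>\<^bsub>R\<^esub> else \<zero>\<^bsub>R\<^esub>)"
  "\<zero>\<^bsub>matrix_ring I R\<^esub> = (\<lambda>_ \<in> I \<times> I. \<zero>\<^bsub>R\<^esub>)"
  "M \<oplus>\<^bsub>matrix_ring I R\<^esub> N = (\<lambda>ij \<in> I \<times> I. M ij \<oplus>\<^bsub>R\<^esub> N ij)"
  by (simp_all add: matrix_ring_def)

lemma matrix_eqI:
  assumes "M \<in> carrier (matrix_ring I R)" "N \<in> carrier (matrix_ring I R)"
    and "\<And>i j. i \<in> I \<Longrightarrow> j \<in> I \<Longrightarrow> M (i, j) = N (i, j)"
  shows "M = N"
  using assms unfolding matrix_ring_simps by (intro PiE_ext) auto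

lemma matrix_mult_nth:
  "i \<in> I \<Longrightarrow> k \<in> I \<Longrightarrow>
    (M \<otimes>\<^bsub>matrix_ring I R\<^esub> N) (i, k) = (\<Oplus>\<^bsub>R\<^esub>j\<in>I. M (i, j) \<otimes>\<^bsub>R\<^esub> N (j, k))"
  by (simp add: matrix_ring_simps)

lemma (in ring) matrix_mult_closed:
  assumes "M \<in> carrier (matrix_ring I R)" "N \<in> carrier (matrix_ring I R)"
  shows "M \<otimes>\<^bsub>matrix_ring I R\<^esub> N \<in> carrier (matrix_ring I R)"
  using assms by (auto simp: matrix_ring_simps PiE_iff intro!: finsum_closed)

lemma (in ring) matrix_mult_assoc:
  assumes I: "finite I"
    and "M \<in> carrier (matrix_ring I R)" "N \<in> carrier (matrix_ring I R)"
      "K \<in> carrier (matrix_ring I R)"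
  shows "(M \<otimes>\<^bsub>matrix_ring I R\<^esub> N) \<otimes>\<^bsub>matrix_ring I R\<^esub> K =
    M \<otimes>\<^bsub>matrix_ring I R\<^esub> (N \<otimes>\<^bsub>matrix_ring I R\<^esub> K)"
proof (rule matrix_eqI[where I = I and R = R])
  have cl: "M (i, j) \<in> carrier R" "N (i, j) \<in> carrier R" "K (i, j) \<in> carrier R"
    if "i \<in> I" "j \<in> I" for i j
    using assms that by (auto simp: matrix_ring_simps)
  fix i k assume ik: "i \<in> I" "k \<in> I"
  have "((M \<otimes>\<^bsub>matrix_ring I R\<^esub> N) \<otimes>\<^bsub>matrix_ring I R\<^esub> K) (i, k) =
    (\<Oplus>j\<in>I. (\<Oplus>h\<in>I. M (i, h) \<otimes> N (h, j)) \<otimes> K (j, k))"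
    using ik cl unfolding matrix_mult_nth[OF ik]
    by (intro finsum_cong') (auto simp: matrix_mult_nth intro!: finsum_closed)
  also have "\<dots> = (\<Oplus>j\<in>I. \<Oplus>h\<in>I. M (i, h) \<otimes> N (h, j) \<otimes> K (j, k))"
    using ik I cl by (intro finsum_cong') (auto intro!: finsum_ldistr finsum_closed)
  also have "\<dots> = (\<Oplus>h\<in>I. \<Oplus>j\<in>I. M (i, h) \<otimes> N (h, j) \<otimes> K (j, k))"
    using ik I cl by (intro finsum_finsum_swap) auto
  also have "\<dots> = (\<Oplus>h\<in>I. M (i, h) \<otimes> (\<Oplus>j\<in>I. N (h, j) \<otimes> K (j, k)))"
    using ik I cl
    by (intro finsum_cong') (auto simp: finsum_rdistr m_assoc intro!: finsum_closed finsum_cong')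
  also have "\<dots> = (M \<otimes>\<^bsub>matrix_ring I R\<^esub> (N \<otimes>\<^bsub>matrix_ring I R\<^esub> K)) (i, k)"
    using ik cl unfolding matrix_mult_nth[OF ik]
    by (intro finsum_cong') (auto simp: matrix_mult_nth intro!: finsum_closed)
  finally show "((M \<otimes>\<^bsub>matrix_ring I R\<^esub> N) \<otimes>\<^bsub>matrix_ring I R\<^esub> K) (i, k) =
    (M \<otimes>\<^bsub>matrix_ring I R\<^esub> (N \<otimes>\<^bsub>matrix_ring I R\<^esub> K)) (i, k)" .
qed (auto intro!: matrix_mult_closed assms)

lemma (in ring) ring_matrix_ring:
  assumes I: "finite I"
  shows "ring (matrix_ring I R)"
proof -
  let ?M = "matrix_ring I R"
  have if_mult: "(if p then \<one> else \<zero>) \<otimes> x = (if p then x else \<zero>)"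
    "x \<otimes> (if p then \<one> else \<zero>) = (if p then x else \<zero>)"
    if "x \<in> carrier R" for p x
    using that by auto
  show ?thesis
  proof (intro ringI abelian_groupI monoidI)
    fix M assume M: "M \<in> carrier ?M"
    have cl: "M (i, j) \<in> carrier R" if "i \<in> I" "j \<in> I" for i j
      using M that by (auto simp: matrix_ring_simps)
    have 1: "\<one>\<^bsub>?M\<^esub> \<in> carrier ?M"
      by (auto simp: matrix_ring_simps)
    show "\<one>\<^bsub>?M\<^esub> \<otimes>\<^bsub>?M\<^esub> M = M"
    proof (rule matrix_eqI)
      fix i k assume ik: "i \<in> I" "k \<in> I"
      then have "(\<one>\<^bsub>?M\<^esub> \<otimes>\<^bsub>?M\<^esub> M) (i, k) =
        (\<Oplus>j\<in>I. if i = j then M (j, k) else \<zero>)"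
        using cl unfolding matrix_mult_nth[OF ik]
        by (intro finsum_cong') (auto simp: if_mult matrix_ring_simps)
      also have "\<dots> = M (i, k)"
        using ik I cl by (intro finsum_singleton) auto
      finally show "(\<one>\<^bsub>?M\<^esub> \<otimes>\<^bsub>?M\<^esub> M) (i, k) = M (i, k)" .
    qed (use M 1 in \<open>auto intro: matrix_mult_closed\<close>)
    show "M \<otimes>\<^bsub>?M\<^esub> \<one>\<^bsub>?M\<^esub> = M"
    proof (rule matrix_eqI)
      fix i k assume ik: "i \<in> I" "k \<in> I"
      \<comment> \<open>The Kronecker delta collapses to a conditional. Its test is turned to
        \<open>k = j\<close>, with the fixed index on the left, which is the form that
        \<open>finsum_singleton\<close> evaluates.\<close>
      then have "(M \<otimes>\<^bsub>?M\<^esub> \<one>\<^bsub>?M\<^esub>) (i, k) =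
        (\<Oplus>j\<in>I. if k = j then M (i, j) else \<zero>)"
        using cl unfolding matrix_mult_nth[OF ik]
        by (intro finsum_cong') (auto simp: if_mult matrix_ring_simps)
      also have "\<dots> = M (i, k)"
        using ik I cl by (intro finsum_singleton) auto
      finally show "(M \<otimes>\<^bsub>?M\<^esub> \<one>\<^bsub>?M\<^esub>) (i, k) = M (i, k)" .
    qed (use M 1 in \<open>auto intro: matrix_mult_closed\<close>)
    have "(\<lambda>ij\<in>I \<times> I. \<ominus> M ij) \<in> carrier ?M"
      using cl by (auto simp: matrix_ring_simps)
    moreover have "(\<lambda>ij\<in>I \<times> I. \<ominus> M ij) \<oplus>\<^bsub>?M\<^esub> M = \<zero>\<^bsub>?M\<^esub>"
      using cl by (auto simp: matrix_ring_simps l_neg)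
    ultimately show "\<exists>N\<in>carrier ?M. N \<oplus>\<^bsub>?M\<^esub> M = \<zero>\<^bsub>?M\<^esub>" by blast
    show "\<zero>\<^bsub>?M\<^esub> \<oplus>\<^bsub>?M\<^esub> M = M"
      using M cl by (intro matrix_eqI) (auto simp: matrix_ring_simps)
  next
    fix L M N assume LMN: "L \<in> carrier ?M" "M \<in> carrier ?M" "N \<in> carrier ?M"
    then have cl: "L (i, j) \<in> carrier R" "M (i, j) \<in> carrier R" "N (i, j) \<in> carrier R"
      if "i \<in> I" "j \<in> I" for i j
      using that by (auto simp: matrix_ring_simps)
    show "(L \<oplus>\<^bsub>?M\<^esub> M) \<otimes>\<^bsub>?M\<^esub> N = L \<otimes>\<^bsub>?M\<^esub> N \<oplus>\<^bsub>?M\<^esub> M \<otimes>\<^bsub>?M\<^esub> N"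
      using cl
      by (auto simp: matrix_ring_simps fun_eq_iff l_distr simp flip: finsum_addf intro!: finsum_cong')
    show "N \<otimes>\<^bsub>?M\<^esub> (L \<oplus>\<^bsub>?M\<^esub> M) = N \<otimes>\<^bsub>?M\<^esub> L \<oplus>\<^bsub>?M\<^esub> N \<otimes>\<^bsub>?M\<^esub> M"
      using cl
      by (auto simp: matrix_ring_simps fun_eq_iff r_distr simp flip: finsum_addf intro!: finsum_cong')
    show "(L \<otimes>\<^bsub>?M\<^esub> M) \<otimes>\<^bsub>?M\<^esub> N = L \<otimes>\<^bsub>?M\<^esub> (M \<otimes>\<^bsub>?M\<^esub> N)"
      using I LMN by (rule matrix_mult_assoc)
    show "(L \<oplus>\<^bsub>?M\<^esub> M) \<oplus>\<^bsub>?M\<^esub> N = L \<oplus>\<^bsub>?M\<^esub> (M \<oplus>\<^bsub>?M\<^esub> N)"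
      using cl by (auto simp: matrix_ring_simps a_assoc)
  next
    fix M N assume "M \<in> carrier ?M" "N \<in> carrier ?M"
    then show "M \<otimes>\<^bsub>?M\<^esub> N \<in> carrier ?M" "M \<oplus>\<^bsub>?M\<^esub> N \<in> carrier ?M"
      "M \<oplus>\<^bsub>?M\<^esub> N = N \<oplus>\<^bsub>?M\<^esub> M"
      by (auto simp: matrix_mult_closed) (auto simp: matrix_ring_simps PiE_iff intro!: a_comm restrict_ext)
  qed (auto simp: matrix_ring_simps)
qed

section \<open>Power series over a noncommutative ring\<close>

lemma series_ring_simps:
  "carrier (series_ring R) = UNIV \<rightarrow> carrier R"
  "f \<otimes>\<^bsub>series_ring R\<^esub> g = (\<lambda>r. \<Oplus>\<^bsub>R\<^esub>s\<in>{..r}. f s \<otimes>\<^bsub>R\<^esub> g (r - s))"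
  "\<one>\<^bsub>series_ring R\<^esub> = (\<lambda>r. if r = 0 then \<one>\<^bsub>R\<^esub> else \<zero>\<^bsub>R\<^esub>)"
  "\<zero>\<^bsub>series_ring R\<^esub> = (\<lambda>r. \<zero>\<^bsub>R\<^esub>)"
  "f \<oplus>\<^bsub>series_ring R\<^esub> g = (\<lambda>r. f r \<oplus>\<^bsub>R\<^esub> g r)"
  by (simp_all add: series_ring_def)

lemma (in ring) series_mult_assoc:
  assumes "f \<in> UNIV \<rightarrow> carrier R" "g \<in> UNIV \<rightarrow> carrier R" "h \<in> UNIV \<rightarrow> carrier R"
  shows "(f \<otimes>\<^bsub>series_ring R\<^esub> g) \<otimes>\<^bsub>series_ring R\<^esub> h =
    f \<otimes>\<^bsub>series_ring R\<^esub> (g \<otimes>\<^bsub>series_ring R\<^esub> h)"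
proof
  have cl: "f i \<in> carrier R" "g i \<in> carrier R" "h i \<in> carrier R" for i
    using assms by auto
  fix r :: nat
  have "(\<Oplus>s\<in>{..r}. (\<Oplus>t\<in>{..s}. f t \<otimes> g (s - t)) \<otimes> h (r - s)) =
    (\<Oplus>s\<in>{..r}. \<Oplus>t\<in>{..s}. f t \<otimes> g (s - t) \<otimes> h (r - s))"
    using cl by (intro finsum_cong') (auto intro!: finsum_ldistr finsum_closed)
  also have "\<dots> = finsum R (\<lambda>(s, t). f t \<otimes> g (s - t) \<otimes> h (r - s)) (Sigma {..r} (\<lambda>s. {..s}))"
    using cl by (intro finsum_Sigma) auto
  \<comment> \<open>The triangle of pairs \<open>t \<le> s \<le> r\<close> is reparametrised by
    \<open>(s, t) \<mapsto> (t, s - t)\<close>, so that the second variable becomes the index of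
    \<open>g\<close>; its inverse is \<open>(t, s) \<mapsto> (t + s, t)\<close>.\<close>
  also have "\<dots> = finsum R (\<lambda>(t, s). f t \<otimes> (g s \<otimes> h (r - t - s))) (Sigma {..r} (\<lambda>t. {..r - t}))"
    using cl
    by (intro finsum_reindex_bij_witness[of _ "\<lambda>(t, s). (t + s, t)" "\<lambda>(s, t). (t, s - t)"])
      (auto simp: m_assoc)
  also have "\<dots> = (\<Oplus>t\<in>{..r}. \<Oplus>s\<in>{..r - t}. f t \<otimes> (g s \<otimes> h (r - t - s)))"
    using cl by (intro finsum_Sigma[symmetric]) auto
  also have "\<dots> = (\<Oplus>t\<in>{..r}. f t \<otimes> (\<Oplus>s\<in>{..r - t}. g s \<otimes> h (r - t - s)))"
    using cl by (intro finsum_cong') (auto simp: finsum_rdistr intro!: finsum_closed)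
  finally show "((f \<otimes>\<^bsub>series_ring R\<^esub> g) \<otimes>\<^bsub>series_ring R\<^esub> h) r =
    (f \<otimes>\<^bsub>series_ring R\<^esub> (g \<otimes>\<^bsub>series_ring R\<^esub> h)) r"
    by (simp add: series_ring_simps)
qed

lemma (in ring) ring_series_ring: "ring (series_ring R)"
proof -
  let ?S = "series_ring R"
  show ?thesis
  proof (intro ringI abelian_groupI monoidI)
    fix f assume "f \<in> carrier ?S"
    then have cl: "f i \<in> carrier R" for i
      by (auto simp: series_ring_simps)
    show "\<one>\<^bsub>?S\<^esub> \<otimes>\<^bsub>?S\<^esub> f = f"
    proof
      fix r
      have "(\<Oplus>s\<in>{..r}. (if s = 0 then \<one> else \<zero>) \<otimes> f (r - s)) =
        (\<Oplus>s\<in>{..r}. if 0 = s then f (r - s) else \<zero>)"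
        using cl by (intro finsum_cong') auto
      also have "\<dots> = f (r - 0)"
        using cl by (intro finsum_singleton) auto
      finally show "(\<one>\<^bsub>?S\<^esub> \<otimes>\<^bsub>?S\<^esub> f) r = f r"
        by (simp add: series_ring_simps)
    qed
    show "f \<otimes>\<^bsub>?S\<^esub> \<one>\<^bsub>?S\<^esub> = f"
    proof
      fix r
      \<comment> \<open>Within \<open>{..r}\<close> the truncated difference \<open>r - s\<close>
        vanishes only at \<open>s = r\<close>.\<close>
      have "(\<Oplus>s\<in>{..r}. f s \<otimes> (if r - s = 0 then \<one> else \<zero>)) =
        (\<Oplus>s\<in>{..r}. if r = s then f s else \<zero>)"
        using cl by (intro finsum_cong') auto
      also have "\<dots> = f r"
        using cl by (intro finsum_singleton) auto
      finally show "(f \<otimes>\<^bsub>?S\<^esub> \<one>\<^bsub>?S\<^esub>) r = f r"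
        by (simp add: series_ring_simps)
    qed
    show "\<exists>g\<in>carrier ?S. g \<oplus>\<^bsub>?S\<^esub> f = \<zero>\<^bsub>?S\<^esub>"
      using cl by (intro bexI[of _ "\<lambda>r. \<ominus> f r"]) (auto simp: series_ring_simps l_neg)
    show "\<zero>\<^bsub>?S\<^esub> \<oplus>\<^bsub>?S\<^esub> f = f"
      using cl by (auto simp: series_ring_simps)
  next
    fix f g h assume fgh: "f \<in> carrier ?S" "g \<in> carrier ?S" "h \<in> carrier ?S"
    then have cl: "f i \<in> carrier R" "g i \<in> carrier R" "h i \<in> carrier R" for i
      by (auto simp: series_ring_simps)
    show "(f \<oplus>\<^bsub>?S\<^esub> g) \<otimes>\<^bsub>?S\<^esub> h = f \<otimes>\<^bsub>?S\<^esub> h \<oplus>\<^bsub>?S\<^esub> g \<otimes>\<^bsub>?S\<^esub> h"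
      using cl by (auto simp: series_ring_simps l_distr finsum_addf)
    show "h \<otimes>\<^bsub>?S\<^esub> (f \<oplus>\<^bsub>?S\<^esub> g) = h \<otimes>\<^bsub>?S\<^esub> f \<oplus>\<^bsub>?S\<^esub> h \<otimes>\<^bsub>?S\<^esub> g"
      using cl by (auto simp: series_ring_simps r_distr finsum_addf)
    show "(f \<otimes>\<^bsub>?S\<^esub> g) \<otimes>\<^bsub>?S\<^esub> h = f \<otimes>\<^bsub>?S\<^esub> (g \<otimes>\<^bsub>?S\<^esub> h)"
      using fgh by (intro series_mult_assoc) (auto simp: series_ring_simps)
    show "(f \<oplus>\<^bsub>?S\<^esub> g) \<oplus>\<^bsub>?S\<^esub> h = f \<oplus>\<^bsub>?S\<^esub> (g \<oplus>\<^bsub>?S\<^esub> h)"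
      using cl by (auto simp: series_ring_simps a_assoc)
  next
    fix f g assume "f \<in> carrier ?S" "g \<in> carrier ?S"
    then have cl: "f i \<in> carrier R" "g i \<in> carrier R" for i
      by (auto simp: series_ring_simps)
    show "f \<otimes>\<^bsub>?S\<^esub> g \<in> carrier ?S" "f \<oplus>\<^bsub>?S\<^esub> g \<in> carrier ?S"
      "f \<oplus>\<^bsub>?S\<^esub> g = g \<oplus>\<^bsub>?S\<^esub> f"
      using cl by (auto simp: series_ring_simps a_comm)
  qed (auto simp: series_ring_simps)
qed

section \<open>Products of sums of transpositions\<close>

lemma ordered_prod_Cons [simp]:
  "ordered_prod G f (x # xs) = f x \<otimes>\<^bsub>G\<^esub> ordered_prod G f xs"
  by (simp add: ordered_prod_def)

lemma ordered_prod_Nil [simp]: "ordered_prod G f [] = \<one>\<^bsub>G\<^esub>"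
  by (simp add: ordered_prod_def)

lemma ordered_prod_cong:
  "(\<And>x. x \<in> set xs \<Longrightarrow> f x = g x) \<Longrightarrow> ordered_prod G f xs = ordered_prod G g xs"
  by (induction xs) simp_all

lemma (in monoid) ordered_prod_closed:
  "(\<And>x. x \<in> set xs \<Longrightarrow> f x \<in> carrier G) \<Longrightarrow> ordered_prod G f xs \<in> carrier G"
  by (induction xs) simp_all

text \<open>Meant for scalar factors \<open>f x\<close> and an arbitrary \<open>y\<close>: a product
  of central scalars is again central.\<close>

lemma (in monoid) ordered_prod_central:
  assumes "y \<in> carrier G" "\<And>x. x \<in> set xs \<Longrightarrow> f x \<in> carrier G"
    and "\<And>x. x \<in> set xs \<Longrightarrow> f x \<otimes> y = y \<otimes> f x"
  shows "ordered_prod G f xs \<otimes> y = y \<otimes> ordered_prod G f xs"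
  using assms
proof (induction xs)
  case (Cons x xs)
  have cl: "f x \<in> carrier G" "ordered_prod G f xs \<in> carrier G"
    using Cons.prems by (auto intro: ordered_prod_closed)
  have "f x \<otimes> ordered_prod G f xs \<otimes> y = f x \<otimes> (y \<otimes> ordered_prod G f xs)"
    using Cons cl by (simp add: m_assoc)
  also have "\<dots> = y \<otimes> (f x \<otimes> ordered_prod G f xs)"
    using Cons.prems cl by (simp flip: m_assoc)
  finally show ?case by simp
qed simp

text \<open>The recursion descends from \<open>n\<close> and reads entry \<open>i\<close> only at
  step \<open>i\<close>. Hence a new entry can be written at an earlier index without disturbing the
  permutation built from the tail.\<close>

lemma p_eta_cong:
  assumes "\<And>j. k \<le> j \<Longrightarrow> \<eta> j = \<eta>' j"
  shows "p_eta n \<eta> k = p_eta n \<eta>' k"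
  using assms
proof (induction "n - k" arbitrary: k)
  case 0
  then show ?case by (simp add: p_eta.simps)
next
  case (Suc d)
  then have "p_eta n \<eta> (Suc k) = p_eta n \<eta>' (Suc k)"
    by simp
  with Suc.prems show ?case
    by (simp add: p_eta.simps[of n \<eta> k] p_eta.simps[of n \<eta>' k])
qed

text \<open>Extends the recursion to \<open>k = n\<close>: there the range forces
  \<open>\<eta> n = n\<close>, so the transposition is trivial and agrees with the initial value
  \<open>id\<close>.\<close>

lemma p_eta_step:
  assumes "k \<le> n" "\<eta> k \<in> {k..n}"
  shows "p_eta n \<eta> k =
    p_eta n \<eta> (Suc k) \<circ> Transposition.transpose k (inv_into UNIV (p_eta n \<eta> (Suc k)) (\<eta> k))"
proof (cases "k = n")
  case True
  with assms show ?thesis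
    by (simp add: p_eta.simps)
next
  case False
  with assms show ?thesis
    by (simp add: p_eta.simps[of n \<eta> k])
qed

text \<open>The expansion below works with tuples given only on a tail \<open>{k..n}\<close>, which
  are not members of \<open>eta_tuples n\<close>; this is \<open>p_eta_permutes\<close> for them,
  including the empty tail.\<close>

lemma p_eta_permutes_tail:
  assumes "\<And>j. j \<in> {k..n} \<Longrightarrow> \<eta> j \<in> {j..n}"
  shows "p_eta n \<eta> k permutes {k..n}"
  using assms
proof (induction "n - k" arbitrary: k)
  case 0
  then show ?case by (simp add: p_eta.simps permutes_def)
next
  case (Suc d)
  have "p_eta n \<eta> (Suc k) permutes {Suc k..n}"
  proof (rule Suc.hyps(1))
    show "d = n - Suc k" using Suc.hyps(2) by simp
  qed (use Suc.prems in simp)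
  then have q: "p_eta n \<eta> (Suc k) permutes {k..n}"
    by (rule permutes_subset) simp
  have kn: "k \<in> {k..n}" using Suc.hyps(2) by simp
  then have "inv_into UNIV (p_eta n \<eta> (Suc k)) (\<eta> k) \<in> {k..n}"
    using Suc.prems permutes_in_image[OF permutes_inv[OF q]] by blast
  with kn have "Transposition.transpose k (inv_into UNIV (p_eta n \<eta> (Suc k)) (\<eta> k)) permutes {k..n}"
    by (rule permutes_swap_id)
  then show ?case
    using p_eta_step[of k n \<eta>] Suc.prems kn q by (simp only: permutes_compose atLeastAtMost_iff)
qed

text \<open>In the application \<open>Q\<close> is the action of permutations, \<open>Y s k\<close>
  is \<open>B\<^sub>s(u - k + 1)\<close> and \<open>c k\<close> is the scalar in
  \<open>\<Pi>\<^sub>k\<close>, sign included. The argument rests on three facts: \<open>Q\<close>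
  is multiplicative, moving \<open>Q \<sigma>\<close> across \<open>Y\<close> changes only the
  position, and each \<open>c k\<close> is central. The induction descends from the empty product at
  \<open>Suc n\<close> and adds one factor on the left each time.\<close>

lemma (in ring) ordered_prod_transposition_sums:
  fixes Q :: "(nat \<Rightarrow> nat) \<Rightarrow> 'a" and Y :: "nat \<Rightarrow> nat \<Rightarrow> 'a" and c :: "nat \<Rightarrow> 'a"
  assumes Q: "\<And>\<sigma>. \<sigma> permutes {1..n} \<Longrightarrow> Q \<sigma> \<in> carrier R"
    and Q_id: "Q id = \<one>"
    and Q_mult: "\<And>\<sigma> \<tau>. \<sigma> permutes {1..n} \<Longrightarrow> \<tau> permutes {1..n} \<Longrightarrow> Q \<sigma> \<otimes> Q \<tau> = Q (\<sigma> \<circ> \<tau>)"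
    and Y: "\<And>s k. s \<in> {1..n} \<Longrightarrow> Y s k \<in> carrier R"
    and Y_Q: "\<And>s k \<sigma>. s \<in> {1..n} \<Longrightarrow> \<sigma> permutes {1..n} \<Longrightarrow> Y s k \<otimes> Q \<sigma> = Q \<sigma> \<otimes> Y (inv_into UNIV \<sigma> s) k"
    and c: "\<And>k. k \<in> {1..n} \<Longrightarrow> c k \<in> carrier R"
    and c_central: "\<And>k x. k \<in> {1..n} \<Longrightarrow> x \<in> carrier R \<Longrightarrow> c k \<otimes> x = x \<otimes> c k"
    and k: "1 \<le> k" "k \<le> Suc n"
  shows "ordered_prod R (\<lambda>k. Y k k \<otimes>
        (\<one> \<oplus> c k \<otimes> (\<Oplus>i\<in>{Suc k..n}. Q (Transposition.transpose k i)))) [k..<Suc n] =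
    (\<Oplus>\<eta>\<in>(\<Pi>\<^sub>E i\<in>{k..n}. {i..n}).
       ordered_prod R (\<lambda>i. if i < \<eta> i then c i else \<one>) [k..<Suc n] \<otimes>
         (Q (inv_into UNIV (p_eta n \<eta> k)) \<otimes> ordered_prod R (\<lambda>i. Y (\<eta> i) i) [k..<Suc n]))"
  using k(2,1)
proof (induction k rule: inc_induct)
  \<comment> \<open>At \<open>k = Suc n\<close> all products are empty, the index set has a single
    element and \<open>p_eta\<close> is the identity.\<close>
  case base
  then show ?case
    using Q_id by (simp add: p_eta.simps id_def)
next
  case (step k)
  have kn: "1 \<le> k" "k \<le> n" "k \<in> {1..n}" using step by auto
  \<comment> \<open>The value at \<open>j = k\<close> belongs to the summand \<one> of the factor,
    because the transposition of \<open>k\<close> with itself is the identity. This makes the whole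
    factor one sum over \<open>{k..n}\<close>.\<close>
  define d where "d j = (if k < j then c k else \<one>)" for j
  let ?E = "\<Pi>\<^sub>E i\<in>{Suc k..n}. {i..n}" and ?t = "Transposition.transpose k"
  define p where "p \<eta> = p_eta n \<eta> (Suc k)" for \<eta>
  define D where "D \<eta> = ordered_prod R (\<lambda>i. if i < \<eta> i then c i else \<one>) [Suc k..<Suc n]" for \<eta>
  define W where "W \<eta> = ordered_prod R (\<lambda>i. Y (\<eta> i) i) [Suc k..<Suc n]" for \<eta>
  have d: "d j \<in> carrier R" for j
    using c kn by (simp add: d_def)
  have d_central: "d j \<otimes> x = x \<otimes> d j" if "x \<in> carrier R" for j x
    using c_central kn that by (simp add: d_def)
  have t: "?t j permutes {1..n}" if "j \<in> {k..n}" for j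
    using that kn by (intro permutes_swap_id) auto
  have E: "\<eta> i \<in> {i..n}" if "\<eta> \<in> ?E" "i \<in> {Suc k..n}" for \<eta> i
    using that by (auto simp: PiE_iff)
  have D: "D \<eta> \<in> carrier R" if "\<eta> \<in> ?E" for \<eta>
    unfolding D_def using kn by (intro ordered_prod_closed) (auto simp: c)
  have D_central: "D \<eta> \<otimes> x = x \<otimes> D \<eta>" if "\<eta> \<in> ?E" "x \<in> carrier R" for \<eta> x
    unfolding D_def using kn that by (intro ordered_prod_central) (auto simp: c c_central)
  have W: "W \<eta> \<in> carrier R" if "\<eta> \<in> ?E" for \<eta>
    unfolding W_def using kn E[OF that] by (intro ordered_prod_closed Y) fastforce
  have p: "p \<eta> permutes {Suc k..n}" if "\<eta> \<in> ?E" for \<eta>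
    unfolding p_def using E[OF that] by (intro p_eta_permutes_tail)
  have p': "p \<eta> permutes {k..n}" "p \<eta> permutes {1..n}" if "\<eta> \<in> ?E" for \<eta>
    using kn by (auto intro: permutes_subset[OF p[OF that]])
  have Qp: "Q (inv_into UNIV (p \<eta>)) \<in> carrier R" if "\<eta> \<in> ?E" for \<eta>
    using p'(2)[OF that] by (intro Q permutes_inv)
  have Yt: "Y k k \<otimes> Q (?t j) \<in> carrier R" if "j \<in> {k..n}" for j
    using Y Q t[OF that] kn by simp
  \<comment> \<open>\<open>T j \<eta>\<close> is the term obtained by choosing \<open>j\<close> in
    factor \<open>k\<close> and the tuple \<open>\<eta>\<close> in the expansion of the remaining
    factors; \<open>G\<close> below is the summand wanted at level \<open>k\<close>.\<close>
  define T where "T j \<eta> = (d j \<otimes> (Y k k \<otimes> Q (?t j))) \<otimes> (D \<eta> \<otimes> (Q (inv_into UNIV (p \<eta>)) \<otimes> W \<eta>))" for j \<eta>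
  have T: "T j \<eta> \<in> carrier R" if "j \<in> {k..n}" "\<eta> \<in> ?E" for j \<eta>
    using that d Yt D Qp W by (simp add: T_def)
  define G where "G \<eta> = ordered_prod R (\<lambda>i. if i < \<eta> i then c i else \<one>) [k..<Suc n] \<otimes>
         (Q (inv_into UNIV (p_eta n \<eta> k)) \<otimes> ordered_prod R (\<lambda>i. Y (\<eta> i) i) [k..<Suc n])" for \<eta>
  \<comment> \<open>The choice \<open>j\<close> is recorded as the entry
    \<open>y = p \<eta> j\<close>, which is exactly what makes the recursion of \<open>p_eta\<close>
    produce \<open>p \<eta> \<circ> ?t j\<close>.\<close>
  have T_eq: "T (inv_into UNIV (p \<eta>) y) \<eta> = G (\<eta>(k := y))" if \<eta>: "\<eta> \<in> ?E" and y: "y \<in> {k..n}" for \<eta> y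
  proof -
    define j where "j = inv_into UNIV (p \<eta>) y"
    note p'' = p'[OF \<eta>]
    have j: "j \<in> {k..n}"
      unfolding j_def using permutes_in_image[OF permutes_inv[OF p''(1)]] y by blast
    have pj: "p \<eta> j = y"
      unfolding j_def using permutes_inverses(1)[OF p''(1)] by simp
    \<comment> \<open>\<open>p \<eta>\<close> moves only indices above \<open>k\<close>, so by
      injectivity \<open>j = k\<close> exactly when \<open>y = k\<close>. The scalar depends on
      nothing else.\<close>
    have pk: "p \<eta> k = k"
      using p[OF \<eta>] by (simp add: permutes_def)
    have "k < j \<longleftrightarrow> k < y"
      using j y pj pk permutes_inj[OF p''(1)] by (metis atLeastAtMost_iff injD order_le_less)
    then have dj: "d j = d y" by (simp add: d_def)
    have pe: "p_eta n (\<eta>(k := y)) (Suc k) = p \<eta>"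
      unfolding p_def by (intro p_eta_cong) auto
    have step: "p_eta n (\<eta>(k := y)) k = p \<eta> \<circ> ?t j"
      using kn y by (subst p_eta_step) (simp_all add: pe j_def)
    have pt: "(p \<eta> \<circ> ?t j) permutes {1..n}"
      using p'' t[OF j] by (intro permutes_compose)
    have inv_pt: "inv_into UNIV (p \<eta> \<circ> ?t j) = ?t j \<circ> inv_into UNIV (p \<eta>)"
      using p''(2) t[OF j] by (simp add: o_inv_distrib permutes_bij)
    have QQ: "Q (?t j) \<otimes> Q (inv_into UNIV (p \<eta>)) = Q (inv_into UNIV (p \<eta> \<circ> ?t j))"
      unfolding inv_pt using p''(2) t[OF j] by (intro Q_mult permutes_inv)
    \<comment> \<open>The new position is the image of \<open>k\<close> under
      \<open>p \<eta> \<circ> ?t j\<close>: the transposition sends \<open>k\<close> to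
      \<open>j\<close>, and \<open>p \<eta>\<close> sends \<open>j\<close> to
      \<open>y\<close>.\<close>
    have Yk: "Y k k \<otimes> Q (inv_into UNIV (p \<eta> \<circ> ?t j)) = Q (inv_into UNIV (p \<eta> \<circ> ?t j)) \<otimes> Y y k"
      using Y_Q[OF kn(3) permutes_inv[OF pt]] permutes_inv_inv[OF pt] pj by simp
    have cl: "Y k k \<in> carrier R" "Y y k \<in> carrier R" "Q (?t j) \<in> carrier R"
      "Q (inv_into UNIV (p \<eta> \<circ> ?t j)) \<in> carrier R"
      using Y kn y Q[OF t[OF j]] Q[OF permutes_inv[OF pt]] by auto
    note cl = cl d D[OF \<eta>] Qp[OF \<eta>] W[OF \<eta>]
    \<comment> \<open>The scalar \<open>D \<eta>\<close> moves to the front, the two permutation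
      operators merge by \<open>QQ\<close>, and \<open>Y k k\<close> then crosses the merged
      operator by \<open>Yk\<close>.\<close>
    have "T j \<eta> = d y \<otimes> (Y k k \<otimes> Q (?t j) \<otimes> D \<eta>) \<otimes> (Q (inv_into UNIV (p \<eta>)) \<otimes> W \<eta>)"
      using cl by (simp add: T_def dj m_assoc)
    also have "Y k k \<otimes> Q (?t j) \<otimes> D \<eta> = D \<eta> \<otimes> (Y k k \<otimes> Q (?t j))"
      using cl by (simp add: D_central[OF \<eta>])
    also have "d y \<otimes> (D \<eta> \<otimes> (Y k k \<otimes> Q (?t j))) \<otimes> (Q (inv_into UNIV (p \<eta>)) \<otimes> W \<eta>) =
      d y \<otimes> D \<eta> \<otimes> (Y k k \<otimes> (Q (?t j) \<otimes> Q (inv_into UNIV (p \<eta>))) \<otimes> W \<eta>)"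
      using cl by (simp add: m_assoc)
    also have "\<dots> = d y \<otimes> D \<eta> \<otimes> (Q (inv_into UNIV (p \<eta> \<circ> ?t j)) \<otimes> (Y y k \<otimes> W \<eta>))"
      unfolding QQ Yk using cl by (simp add: m_assoc)
    also have "D \<eta> = ordered_prod R (\<lambda>i. if i < (\<eta>(k := y)) i then c i else \<one>) [Suc k..<Suc n]"
      unfolding D_def by (intro ordered_prod_cong) auto
    also have "W \<eta> = ordered_prod R (\<lambda>i. Y ((\<eta>(k := y)) i) i) [Suc k..<Suc n]"
      unfolding W_def by (intro ordered_prod_cong) auto
    finally show ?thesis
      using kn by (simp add: G_def upt_conv_Cons d_def step j_def comp_def del: upt_Suc)
  qed
  have G: "G (\<eta>(k := y)) \<in> carrier R" if "\<eta> \<in> ?E" and "y \<in> {k..n}" for \<eta> y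
  proof -
    have "inv_into UNIV (p \<eta>) y \<in> {k..n}"
      using permutes_in_image[OF permutes_inv[OF p'(1)]] that by blast
    then show ?thesis
      using T that unfolding T_eq[OF that, symmetric] by simp
  qed
  let ?F = "\<lambda>k. Y k k \<otimes> (\<one> \<oplus> c k \<otimes> (\<Oplus>i\<in>{Suc k..n}. Q (Transposition.transpose k i)))"
  have fin: "finite ?E"
    by (intro finite_PiE) auto
  have "\<one> \<oplus> c k \<otimes> (\<Oplus>i\<in>{Suc k..n}. Q (?t i)) = d k \<otimes> Q (?t k) \<oplus> (\<Oplus>i\<in>{Suc k..n}. d i \<otimes> Q (?t i))"
    using kn t Q c by (auto simp: d_def Q_id finsum_rdistr Pi_iff intro!: finsum_cong' arg_cong2[where f = "(\<oplus>)"])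
  also have "\<dots> = (\<Oplus>j\<in>{k..n}. d j \<otimes> Q (?t j))"
    using kn t Q d by (subst atLeastAtMost_insertL[symmetric]) (auto simp: Pi_iff)
  finally have "Y k k \<otimes> (\<one> \<oplus> c k \<otimes> (\<Oplus>i\<in>{Suc k..n}. Q (?t i))) =
    (\<Oplus>j\<in>{k..n}. Y k k \<otimes> (d j \<otimes> Q (?t j)))"
    using Y kn d Q t by (simp add: finsum_rdistr Pi_iff)
  also have "\<dots> = (\<Oplus>j\<in>{k..n}. d j \<otimes> (Y k k \<otimes> Q (?t j)))"
  proof (intro finsum_cong' refl)
    fix j assume "j \<in> {k..n}"
    then show "Y k k \<otimes> (d j \<otimes> Q (?t j)) = d j \<otimes> (Y k k \<otimes> Q (?t j))"
      using Y[OF kn(3)] d Q[OF t] by (simp add: d_central[OF Y[OF kn(3)], symmetric] flip: m_assoc)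
  qed (use d Yt in auto)
  finally have F: "?F k = (\<Oplus>j\<in>{k..n}. d j \<otimes> (Y k k \<otimes> Q (?t j)))" .
  have IH: "ordered_prod R ?F [Suc k..<Suc n] =
    (\<Oplus>\<eta>\<in>?E. D \<eta> \<otimes> (Q (inv_into UNIV (p \<eta>)) \<otimes> W \<eta>))"
    unfolding D_def W_def p_def by (rule step.IH) simp
  have "ordered_prod R ?F [k..<Suc n] = ?F k \<otimes> ordered_prod R ?F [Suc k..<Suc n]"
    using kn by (simp add: upt_conv_Cons del: upt_Suc)
  also have "\<dots> = (\<Oplus>j\<in>{k..n}. d j \<otimes> (Y k k \<otimes> Q (?t j))) \<otimes>
      (\<Oplus>\<eta>\<in>?E. D \<eta> \<otimes> (Q (inv_into UNIV (p \<eta>)) \<otimes> W \<eta>))"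
    by (simp only: F IH)
  also have "\<dots> = (\<Oplus>j\<in>{k..n}. \<Oplus>\<eta>\<in>?E. T j \<eta>)"
    unfolding T_def using fin d Yt D W Qp by (intro finsum_product) auto
  also have "\<dots> = (\<Oplus>\<eta>\<in>?E. \<Oplus>j\<in>{k..n}. T j \<eta>)"
    using fin T by (intro finsum_finsum_swap) auto
  also have "\<dots> = (\<Oplus>\<eta>\<in>?E. \<Oplus>y\<in>{k..n}. G (\<eta>(k := y)))"
  proof (rule finsum_cong'[OF refl])
    fix \<eta> assume \<eta>: "\<eta> \<in> ?E"
    \<comment> \<open>For fixed \<open>\<eta>\<close> the inverse of \<open>p \<eta>\<close> maps
      \<open>{k..n}\<close> onto itself, so the sum over choices \<open>j\<close> is a sum over
      entries \<open>y\<close>.\<close>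
    note q = permutes_inv[OF p'(1)[OF \<eta>]]
    have "(\<Oplus>j\<in>inv_into UNIV (p \<eta>) ` {k..n}. T j \<eta>) = (\<Oplus>y\<in>{k..n}. T (inv_into UNIV (p \<eta>) y) \<eta>)"
      using T \<eta> permutes_image[OF q]
      by (intro finsum_reindex) (auto intro: inj_on_subset[OF permutes_inj[OF q]])
    also have "\<dots> = (\<Oplus>y\<in>{k..n}. G (\<eta>(k := y)))"
      using \<eta> G by (intro finsum_cong') (auto simp: T_eq)
    finally show "(\<Oplus>j\<in>{k..n}. T j \<eta>) = (\<Oplus>y\<in>{k..n}. G (\<eta>(k := y)))"
      unfolding permutes_image[OF q] .
  qed (use G in \<open>auto intro!: finsum_closed\<close>)
  \<comment> \<open>The entry \<open>y\<close> is put first to match the order of pairs in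
    \<open>inj_combinator\<close> and \<open>PiE_insert_eq\<close>, which glue \<open>y\<close> and
    the tail into a tuple on \<open>{k..n}\<close>.\<close>
  also have "\<dots> = (\<Oplus>y\<in>{k..n}. \<Oplus>\<eta>\<in>?E. G (\<eta>(k := y)))"
    using fin G by (intro finsum_finsum_swap) auto
  also have "\<dots> = finsum R (\<lambda>(y, \<eta>). G (\<eta>(k := y))) ({k..n} \<times> ?E)"
    using fin G by (intro add.finprod_finprod) auto
  also have "\<dots> = finsum R G ((\<lambda>(y, \<eta>). \<eta>(k := y)) ` ({k..n} \<times> ?E))"
    using G inj_combinator[of k "{Suc k..n}" "\<lambda>i. {i..n}"]
    by (subst finsum_reindex) (auto simp: case_prod_unfold)
  also have "(\<lambda>(y, \<eta>). \<eta>(k := y)) ` ({k..n} \<times> ?E) = (\<Pi>\<^sub>E i\<in>{k..n}. {i..n})"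
    using kn PiE_insert_eq[of k "{Suc k..n}" "\<lambda>i. {i..n}"] by (simp add: atLeastAtMost_insertL)
  finally show ?case
    unfolding G_def .
qed

section \<open>Permutation operators and scalar matrices\<close>

text \<open>A permutation of \<open>{1..n}\<close> fixes every other point, so the default value
  \<open>undefined\<close> outside survives the composition.\<close>

lemma comp_permutes_tuples:
  assumes "p permutes {1..n}" "a \<in> tuples n"
  shows "a \<circ> p \<in> tuples n"
proof (intro PiE_I)
  fix t assume "t \<in> {1..n}"
  then show "(a \<circ> p) t \<in> {1..n}"
    using assms permutes_in_image[OF assms(1)] by (auto simp: PiE_iff)
next
  fix t assume "t \<notin> {1..n}"
  then show "(a \<circ> p) t = undefined"
    using assms by (auto simp: permutes_not_in PiE_iff extensional_def)
qed

text \<open>The first form locates the nonzero column of a given row of a permutation matrix, the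
  second the nonzero row of a given column.\<close>

lemma comp_permutes_eq_iff:
  assumes "p permutes {1..n}" "a \<in> tuples n" "b \<in> tuples n"
  shows "(\<forall>t\<in>{1..n}. a (p t) = b t) \<longleftrightarrow> a \<circ> p = b"
    "(\<forall>t\<in>{1..n}. a (p t) = b t) \<longleftrightarrow> b \<circ> inv_into UNIV p = a"
proof -
  show 1: "(\<forall>t\<in>{1..n}. a (p t) = b t) \<longleftrightarrow> a \<circ> p = b"
    using PiE_ext[OF comp_permutes_tuples[OF assms(1,2)] assms(3)] by auto
  have "a \<circ> p = b \<longleftrightarrow> b \<circ> inv_into UNIV p = a"
    using permutes_inv_o[OF assms(1)] by (metis comp_assoc comp_id)
  with 1 show "(\<forall>t\<in>{1..n}. a (p t) = b t) \<longleftrightarrow> b \<circ> inv_into UNIV p = a"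
    by simp
qed

context ring
begin

lemma perm_op_closed: "perm_op n R p \<in> carrier (tensor_ring n R)"
  unfolding perm_op_def matrix_ring_simps(1) by (auto simp: restrict_PiE_iff)

lemma in_position_closed:
  assumes "s \<in> {1..n}" "M \<in> {1..n} \<times> {1..n} \<rightarrow> carrier R"
  shows "in_position n R s M \<in> carrier (tensor_ring n R)"
  using assms unfolding in_position_def matrix_ring_simps(1) by (auto simp: PiE_iff Pi_iff)

lemma perm_op_nth:
  assumes "p permutes {1..n}" "a \<in> tuples n" "c \<in> tuples n"
  shows "perm_op n R p (a, c) = (if a \<circ> p = c then \<one> else \<zero>)"
    "perm_op n R p (a, c) = (if c \<circ> inv_into UNIV p = a then \<one> else \<zero>)"
  unfolding comp_permutes_eq_iff[OF assms, symmetric] using assms by (simp_all add: perm_op_def)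

text \<open>Row \<open>a\<close> of the permutation matrix has its only nonzero entry in column
  \<open>a \<circ> p\<close>, so one summand survives. The next lemma is the same argument for
  columns, with the inverse permutation.\<close>

lemma perm_op_mult_nth:
  assumes "p permutes {1..n}" "M \<in> carrier (tensor_ring n R)" "a \<in> tuples n" "c \<in> tuples n"
  shows "(perm_op n R p \<otimes>\<^bsub>tensor_ring n R\<^esub> M) (a, c) = M (a \<circ> p, c)"
proof -
  have M: "M (b, c) \<in> carrier R" if "b \<in> tuples n" for b
    using assms(2,4) that unfolding matrix_ring_simps(1) by (auto)
  have "(perm_op n R p \<otimes>\<^bsub>tensor_ring n R\<^esub> M) (a, c) =
    (\<Oplus>b\<in>tuples n. if a \<circ> p = b then M (b, c) else \<zero>)"
    unfolding matrix_mult_nth[OF assms(3,4)]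
    using M assms(1,3) by (intro finsum_cong') (auto simp: perm_op_nth(1))
  also have "\<dots> = M (a \<circ> p, c)"
    using M comp_permutes_tuples[OF assms(1,3)] by (intro finsum_singleton) (auto intro: finite_PiE)
  finally show ?thesis .
qed

lemma mult_perm_op_nth:
  assumes "p permutes {1..n}" "M \<in> carrier (tensor_ring n R)" "a \<in> tuples n" "c \<in> tuples n"
  shows "(M \<otimes>\<^bsub>tensor_ring n R\<^esub> perm_op n R p) (a, c) = M (a, c \<circ> inv_into UNIV p)"
proof -
  have M: "M (a, b) \<in> carrier R" if "b \<in> tuples n" for b
    using assms(2,3) that unfolding matrix_ring_simps(1) by auto
  have "(M \<otimes>\<^bsub>tensor_ring n R\<^esub> perm_op n R p) (a, c) =
    (\<Oplus>b\<in>tuples n. if c \<circ> inv_into UNIV p = b then M (a, b) else \<zero>)"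
    unfolding matrix_mult_nth[OF assms(3,4)]
    using M assms(1,4) by (intro finsum_cong') (auto simp: perm_op_nth(2))
  also have "\<dots> = M (a, c \<circ> inv_into UNIV p)"
    using M comp_permutes_tuples[OF permutes_inv[OF assms(1)] assms(4)]
    by (intro finsum_singleton) (auto intro: finite_PiE)
  finally show ?thesis .
qed

lemma perm_op_id: "perm_op n R id = \<one>\<^bsub>tensor_ring n R\<^esub>"
proof -
  have "(\<forall>t\<in>{1..n}. a (id t) = c t) \<longleftrightarrow> a = c" if "a \<in> tuples n" "c \<in> tuples n" for a c
    using comp_permutes_eq_iff(1)[OF permutes_id that] by simp
  then show ?thesis
    unfolding perm_op_def matrix_ring_simps by (intro restrict_ext) auto
qed

lemma perm_op_mult:
  assumes "p permutes {1..n}" "q permutes {1..n}"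
  shows "perm_op n R p \<otimes>\<^bsub>tensor_ring n R\<^esub> perm_op n R q = perm_op n R (p \<circ> q)"
proof (rule matrix_eqI[where R = R])
  fix a c assume ac: "a \<in> tuples n" "c \<in> tuples n"
  show "(perm_op n R p \<otimes>\<^bsub>tensor_ring n R\<^esub> perm_op n R q) (a, c) = perm_op n R (p \<circ> q) (a, c)"
    using perm_op_mult_nth[OF assms(1) perm_op_closed ac] ac comp_permutes_tuples[OF assms(1) ac(1)]
    by (simp add: perm_op_def)
qed (intro matrix_mult_closed perm_op_closed)+

text \<open>The commutation rule that carries a permutation operator to the left of
  \<open>B\<^sub>s\<close>; it supplies the assumption \<open>Y_Q\<close> of
  \<open>ordered_prod_transposition_sums\<close>.\<close>

lemma in_position_mult_perm_op:
  assumes p: "p permutes {1..n}" and s: "s \<in> {1..n}" and M: "M \<in> {1..n} \<times> {1..n} \<rightarrow> carrier R"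
  shows "in_position n R s M \<otimes>\<^bsub>tensor_ring n R\<^esub> perm_op n R p =
    perm_op n R p \<otimes>\<^bsub>tensor_ring n R\<^esub> in_position n R (inv_into UNIV p s) M"
proof (rule matrix_eqI)
  let ?q = "inv_into UNIV p"
  note q = permutes_inv[OF p]
  have q_s: "?q s \<in> {1..n}"
    using s permutes_in_image[OF q] by blast
  show "in_position n R s M \<otimes>\<^bsub>tensor_ring n R\<^esub> perm_op n R p \<in> carrier (tensor_ring n R)"
    "perm_op n R p \<otimes>\<^bsub>tensor_ring n R\<^esub> in_position n R (?q s) M \<in> carrier (tensor_ring n R)"
    using s q_s M by (intro matrix_mult_closed perm_op_closed in_position_closed; simp)+
  fix a c assume ac: "a \<in> tuples n" "c \<in> tuples n"
  \<comment> \<open>Substituting \<open>p t\<close> for \<open>t\<close> turns the excluded position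
    \<open>s\<close> into \<open>?q s\<close>; the entry of \<open>M\<close> is then the same on
    both sides.\<close>
  have "(\<forall>t\<in>{1..n} - {s}. a t = c (?q t)) \<longleftrightarrow> (\<forall>t\<in>p ` ({1..n} - {?q s}). a t = c (?q t))"
    using permutes_image[OF p] permutes_inverses(1)[OF p] permutes_inj[OF p]
    by (simp add: image_set_diff)
  also have "\<dots> \<longleftrightarrow> (\<forall>t\<in>{1..n} - {?q s}. a (p t) = c t)"
    using permutes_inverses(2)[OF p] by simp
  finally show "(in_position n R s M \<otimes>\<^bsub>tensor_ring n R\<^esub> perm_op n R p) (a, c) =
    (perm_op n R p \<otimes>\<^bsub>tensor_ring n R\<^esub> in_position n R (?q s) M) (a, c)"
    using ac comp_permutes_tuples[OF p ac(1)] comp_permutes_tuples[OF q ac(2)]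
      permutes_inverses(1)[OF p]
    unfolding mult_perm_op_nth[OF p in_position_closed[OF s M] ac]
      perm_op_mult_nth[OF p in_position_closed[OF q_s M] ac]
    by (simp add: in_position_def)
qed

section \<open>Scalar multiples of matrices\<close>

lemma matrix_scale_closed:
  assumes "s \<in> carrier R" "M \<in> carrier (matrix_ring I R)"
  shows "matrix_scale I R s M \<in> carrier (matrix_ring I R)"
  using assms by (auto simp: matrix_scale_def matrix_ring_simps PiE_iff)

text \<open>Expresses scaling as multiplication by a scalar matrix, so that scalars can be handled
  as elements of the matrix ring.\<close>

lemma matrix_scale_one_mult:
  assumes "finite I" "s \<in> carrier R" "M \<in> carrier (matrix_ring I R)"
  shows "matrix_scale I R s \<one>\<^bsub>matrix_ring I R\<^esub> \<otimes>\<^bsub>matrix_ring I R\<^esub> M = matrix_scale I R s M"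
proof -
  interpret M: ring "matrix_ring I R"
    by (rule ring_matrix_ring[OF assms(1)])
  have M: "M (i, j) \<in> carrier R" if "i \<in> I" "j \<in> I" for i j
    using assms(3) that by (auto simp: matrix_ring_simps)
  show ?thesis
  proof (rule matrix_eqI)
    fix i k assume ik: "i \<in> I" "k \<in> I"
    have "(matrix_scale I R s \<one>\<^bsub>matrix_ring I R\<^esub> \<otimes>\<^bsub>matrix_ring I R\<^esub> M) (i, k) =
      (\<Oplus>j\<in>I. if i = j then s \<otimes> M (j, k) else \<zero>)"
      unfolding matrix_mult_nth[OF ik] using ik M assms(2)
      by (intro finsum_cong') (auto simp: matrix_scale_def matrix_ring_simps)
    also have "\<dots> = s \<otimes> M (i, k)"
      using ik M assms by (intro finsum_singleton) auto
    finally show "(matrix_scale I R s \<one>\<^bsub>matrix_ring I R\<^esub> \<otimes>\<^bsub>matrix_ring I R\<^esub> M) (i, k) =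
      matrix_scale I R s M (i, k)"
      using ik by (simp add: matrix_scale_def)
  qed (use assms in \<open>auto intro: matrix_scale_closed\<close>)
qed

text \<open>Multiplying from the right puts \<open>s\<close> behind each entry, and centrality of
  \<open>s\<close> moves it back. Together with the left version this makes the scalar matrix
  central.\<close>

lemma mult_matrix_scale_one:
  assumes "finite I" "s \<in> carrier R" "M \<in> carrier (matrix_ring I R)"
    and "\<And>x. x \<in> carrier R \<Longrightarrow> s \<otimes> x = x \<otimes> s"
  shows "M \<otimes>\<^bsub>matrix_ring I R\<^esub> matrix_scale I R s \<one>\<^bsub>matrix_ring I R\<^esub> = matrix_scale I R s M"
proof -
  interpret M: ring "matrix_ring I R"
    by (rule ring_matrix_ring[OF assms(1)])
  have M: "M (i, j) \<in> carrier R" if "i \<in> I" "j \<in> I" for i j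
    using assms(3) that by (auto simp: matrix_ring_simps)
  show ?thesis
  proof (rule matrix_eqI)
    fix i k assume ik: "i \<in> I" "k \<in> I"
    have "(M \<otimes>\<^bsub>matrix_ring I R\<^esub> matrix_scale I R s \<one>\<^bsub>matrix_ring I R\<^esub>) (i, k) =
      (\<Oplus>j\<in>I. if k = j then s \<otimes> M (i, j) else \<zero>)"
      unfolding matrix_mult_nth[OF ik] using ik M assms(2,4)
      by (intro finsum_cong') (auto simp: matrix_scale_def matrix_ring_simps)
    also have "\<dots> = s \<otimes> M (i, k)"
      using ik M assms by (intro finsum_singleton) auto
    finally show "(M \<otimes>\<^bsub>matrix_ring I R\<^esub> matrix_scale I R s \<one>\<^bsub>matrix_ring I R\<^esub>) (i, k) =
      matrix_scale I R s M (i, k)"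
      using ik by (simp add: matrix_scale_def)
  qed (use assms in \<open>auto intro: matrix_scale_closed\<close>)
qed

lemma matrix_scale_mult:
  assumes "s \<in> carrier R" "t \<in> carrier R" "M \<in> carrier (matrix_ring I R)"
  shows "matrix_scale I R (s \<otimes> t) M = matrix_scale I R s (matrix_scale I R t M)"
  using assms by (fastforce simp: matrix_scale_def matrix_ring_simps intro!: restrict_ext m_assoc)

lemma matrix_scale_one:
  assumes "M \<in> carrier (matrix_ring I R)"
  shows "matrix_scale I R \<one> M = M"
proof (rule matrix_eqI)
  fix i j assume "i \<in> I" "j \<in> I"
  moreover from this have "M (i, j) \<in> carrier R"
    using assms by (auto simp: matrix_ring_simps)
  ultimately show "matrix_scale I R \<one> M (i, j) = M (i, j)"
    by (simp add: matrix_scale_def)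
qed (use assms in \<open>auto intro: matrix_scale_closed\<close>)

lemma matrix_scale_a_inv:
  assumes "finite I" "s \<in> carrier R" "M \<in> carrier (matrix_ring I R)"
  shows "matrix_scale I R (\<ominus> s) M = \<ominus>\<^bsub>matrix_ring I R\<^esub> matrix_scale I R s M"
proof -
  interpret M: ring "matrix_ring I R"
    by (rule ring_matrix_ring[OF assms(1)])
  have M: "M (i, j) \<in> carrier R" if "i \<in> I" "j \<in> I" for i j
    using assms(3) that by (auto simp: matrix_ring_simps)
  have "matrix_scale I R (\<ominus> s) M \<oplus>\<^bsub>matrix_ring I R\<^esub> matrix_scale I R s M = \<zero>\<^bsub>matrix_ring I R\<^esub>"
    using M assms(2) by (auto simp: matrix_scale_def matrix_ring_simps l_minus l_neg intro!: restrict_ext)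
  then show ?thesis
    using assms by (intro M.minus_equality[symmetric] matrix_scale_closed) auto
qed

end

section \<open>Scalar series over the reflection algebra\<close>

text \<open>The empty word is neutral and complex coefficients commute, which settles single
  monomials. Updating at a word outside the support adds one monomial, so additivity finishes the
  induction.\<close>

lemma const_commute: "const c * p = p * const c"
proof (induction p rule: Poly_Mapping.update_induct)
  case (update p w b)
  have "Poly_Mapping.update w b p = Poly_Mapping.single w b + p"
    using update(1)
    by (intro poly_mapping_eqI)
      (auto simp: lookup_update lookup_add lookup_single in_keys_iff when_def)
  with update(3) show ?case
    by (simp add: distrib_left distrib_right const_def mult_single mult.commute)
qed simp

lemma refl_free_algebra_simps:
  "p \<otimes>\<^bsub>refl_free_algebra m l\<^esub> q = p * q" "p \<oplus>\<^bsub>refl_free_algebra m l\<^esub> q = p + q"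
  "\<one>\<^bsub>refl_free_algebra m l\<^esub> = 1" "\<zero>\<^bsub>refl_free_algebra m l\<^esub> = 0"
  by (simp_all add: refl_free_algebra_def free_algebra_def ring_of_type_algebra_def)

lemma const_in_refl_free_algebra: "const c \<in> carrier (refl_free_algebra m l)"
  unfolding refl_free_algebra_def by (rule free_algebra_closed)

lemma ring_hom_ring_refl_class:
  "ring_hom_ring (refl_free_algebra m l) (reflection_algebra m l) (refl_class m l)"
proof -
  interpret ring "refl_free_algebra m l"
    unfolding refl_free_algebra_def by (rule ring_free_algebra)
  have "ideal (refl_ideal m l) (refl_free_algebra m l)"
    unfolding refl_ideal_def by (intro genideal_ideal refl_relators_in_carrier)
  moreover have "refl_class m l = (+>\<^bsub>refl_free_algebra m l\<^esub>) (refl_ideal m l)"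
    by (simp add: fun_eq_iff refl_class_def)
  ultimately show ?thesis
    unfolding reflection_algebra_def by (simp add: ideal.rcos_ring_hom_ring)
qed

text \<open>The quotient map is a ring homomorphism and \<open>const\<close> respects sums and
  products, so \<open>h\<close> is the structure map of the complex algebra.\<close>

lemma refl_class_const:
  fixes m l :: nat
  defines "A \<equiv> reflection_algebra m l" and "h \<equiv> \<lambda>c. refl_class m l (const c)"
  shows "h a \<in> carrier A" "h (a + b) = h a \<oplus>\<^bsub>A\<^esub> h b" "h (a * b) = h a \<otimes>\<^bsub>A\<^esub> h b"
    "h 1 = \<one>\<^bsub>A\<^esub>" "h 0 = \<zero>\<^bsub>A\<^esub>"
proof -
  interpret h: ring_hom_ring "refl_free_algebra m l" A "refl_class m l"
    unfolding A_def by (rule ring_hom_ring_refl_class)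
  note c = const_in_refl_free_algebra[of _ m l]
  show "h a \<in> carrier A"
    unfolding h_def by (intro h.hom_closed c)
  have "const (a + b) = const a \<oplus>\<^bsub>refl_free_algebra m l\<^esub> const b"
    by (simp add: refl_free_algebra_simps const_def single_add)
  then show "h (a + b) = h a \<oplus>\<^bsub>A\<^esub> h b"
    unfolding h_def by (simp only: h.hom_add c)
  have "const (a * b) = const a \<otimes>\<^bsub>refl_free_algebra m l\<^esub> const b"
    by (simp add: refl_free_algebra_simps const_def mult_single)
  then show "h (a * b) = h a \<otimes>\<^bsub>A\<^esub> h b"
    unfolding h_def by (simp only: h.hom_mult c)
  have "const 1 = \<one>\<^bsub>refl_free_algebra m l\<^esub>"
    by (simp add: refl_free_algebra_simps const_def)
  then show "h 1 = \<one>\<^bsub>A\<^esub>"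
    unfolding h_def by (simp only: h.hom_one)
  have "const 0 = \<zero>\<^bsub>refl_free_algebra m l\<^esub>"
    by (simp add: refl_free_algebra_simps const_def)
  then show "h 0 = \<zero>\<^bsub>A\<^esub>"
    unfolding h_def by (simp only: h.hom_zero)
qed

text \<open>Each element has a representative in the free algebra, where constants commute with
  everything.\<close>

lemma refl_class_const_commute:
  assumes "x \<in> carrier (reflection_algebra m l)"
  shows "refl_class m l (const a) \<otimes>\<^bsub>reflection_algebra m l\<^esub> x =
    x \<otimes>\<^bsub>reflection_algebra m l\<^esub> refl_class m l (const a)"
proof -
  interpret h: ring_hom_ring "refl_free_algebra m l" "reflection_algebra m l" "refl_class m l"
    by (rule ring_hom_ring_refl_class)
  obtain p where p: "p \<in> carrier (refl_free_algebra m l)" "x = refl_class m l p"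
    using assms unfolding reflection_algebra_def refl_class_def
    by (auto simp: FactRing_def A_RCOSETS_def')
  have "const a \<otimes>\<^bsub>refl_free_algebra m l\<^esub> p = p \<otimes>\<^bsub>refl_free_algebra m l\<^esub> const a"
    by (simp add: refl_free_algebra_simps const_commute)
  then show ?thesis
    using p(1) const_in_refl_free_algebra unfolding p(2) by (simp flip: h.hom_mult)
qed

lemma refl_class_const_sum:
  assumes "finite I"
  shows "refl_class m l (const (\<Sum>i\<in>I. f i)) =
    (\<Oplus>\<^bsub>reflection_algebra m l\<^esub>i\<in>I. refl_class m l (const (f i)))"
proof -
  interpret ring "reflection_algebra m l"
    by (rule ring_reflection_algebra)
  show ?thesis
    using assms by (induction I) (simp_all add: refl_class_const Pi_def)
qed

section \<open>Scalar power series as central elements\<close>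

lemma scalar_series_closed: "scalar_series m l f \<in> carrier (refl_series m l)"
  by (simp add: scalar_series_def series_ring_simps refl_class_const)

lemma scalar_series_one: "scalar_series m l 1 = \<one>\<^bsub>refl_series m l\<^esub>"
  by (simp add: scalar_series_def series_ring_simps refl_class_const fun_eq_iff)

text \<open>\<open>scalar_series\<close> discards positive powers of \<open>u\<close>, which could
  still contribute to a product; the subdegree bounds exclude them. Both factors are then power
  series in \<open>u\<^sup>-\<^sup>1\<close>, and the Laurent product is the Cauchy product.\<close>

lemma scalar_series_mult:
  assumes "0 \<le> fls_subdegree f" "0 \<le> fls_subdegree g"
  shows "scalar_series m l (f * g) = scalar_series m l f \<otimes>\<^bsub>refl_series m l\<^esub> scalar_series m l g"
proof
  interpret ring "reflection_algebra m l"
    by (rule ring_reflection_algebra)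
  fix k :: nat
  obtain F G where FG: "f = fps_to_fls F" "g = fps_to_fls G"
    using assms by (metis fls_regpart_to_fls_trivial)
  have nth: "fls_nth (f * g) (int k) = (\<Sum>s\<in>{..k}. fls_nth f (int s) * fls_nth g (int (k - s)))"
    unfolding FG fls_times_fps_to_fls[symmetric] by (simp add: fps_mult_nth atMost_atLeast0 flip: of_nat_diff)
  show "scalar_series m l (f * g) k =
    (scalar_series m l f \<otimes>\<^bsub>refl_series m l\<^esub> scalar_series m l g) k"
    unfolding scalar_series_def series_ring_simps nth
    by (simp only: refl_class_const_sum finite_atMost refl_class_const)
qed

lemma scalar_series_uminus:
  "scalar_series m l (- f) = \<ominus>\<^bsub>refl_series m l\<^esub> scalar_series m l f"
proof -
  interpret A: ring "reflection_algebra m l"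
    by (rule ring_reflection_algebra)
  interpret S: ring "refl_series m l"
    by (rule A.ring_series_ring)
  have "scalar_series m l (- f) \<oplus>\<^bsub>refl_series m l\<^esub> scalar_series m l f = \<zero>\<^bsub>refl_series m l\<^esub>"
    by (simp add: scalar_series_def series_ring_simps flip: refl_class_const(2))
      (simp add: refl_class_const)
  then show ?thesis
    by (intro S.minus_equality[symmetric] scalar_series_closed)
qed

lemma scalar_series_central:
  assumes "x \<in> carrier (refl_series m l)"
  shows "scalar_series m l f \<otimes>\<^bsub>refl_series m l\<^esub> x = x \<otimes>\<^bsub>refl_series m l\<^esub> scalar_series m l f"
proof
  interpret A: ring "reflection_algebra m l"
    by (rule ring_reflection_algebra)
  have x: "x i \<in> carrier (reflection_algebra m l)" for i
    using assms by (auto simp: series_ring_simps)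
  fix k :: nat
  show "(scalar_series m l f \<otimes>\<^bsub>refl_series m l\<^esub> x) k =
    (x \<otimes>\<^bsub>refl_series m l\<^esub> scalar_series m l f) k"
    unfolding series_ring_simps scalar_series_def
    \<comment> \<open>Reversing the Cauchy sum by \<open>s \<mapsto> k - s\<close> pairs equal
      coefficients, and constant coefficients commute with those of \<open>x\<close>.\<close>
    by (rule A.finsum_reindex_bij_witness[of _ "\<lambda>s. k - s" "\<lambda>s. k - s"])
      (auto simp: refl_class_const refl_class_const_commute x)
qed

lemma b_shift_closed:
  assumes "ij \<in> {1..m + l} \<times> {1..m + l}"
  shows "b_shift m l c ij \<in> carrier (refl_series m l)"
proof -
  interpret h: ring_hom_ring "refl_free_algebra m l" "reflection_algebra m l" "refl_class m l"
    by (rule ring_hom_ring_refl_class)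
  have "refl_class m l (gen (fst ij, snd ij, r)) \<in> carrier (reflection_algebra m l)" for r
    using assms unfolding refl_free_algebra_def
    by (intro h.hom_closed) (auto simp: refl_free_algebra_def intro!: free_algebra_closed)
  then show ?thesis
    using scalar_series_closed
    by (auto simp: b_shift_def series_ring_simps case_prod_unfold Pi_iff intro!: h.S.finsum_closed)
qed

text \<open>The denominator has coefficient -2 at \<open>u\<close>, that is at index -1, so its
  subdegree is negative. Inversion flips the sign, leaving a power series in
  \<open>u\<^sup>-\<^sup>1\<close>, as \<open>scalar_series_mult\<close> requires.\<close>

lemma alpha_factor_subdegree:
  "0 \<le> fls_subdegree (1 / (of_nat n - 2 * fls_X_inv - 2 + of_nat i :: complex fls))"
proof -
  have "fls_nth (of_nat n - 2 * fls_X_inv - 2 + of_nat i :: complex fls) (-1) \<noteq> 0"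
    by (simp add: fls_of_nat_nth)
  then have "fls_subdegree (of_nat n - 2 * fls_X_inv - 2 + of_nat i :: complex fls) \<le> -1"
    by (rule fls_subdegree_leI)
  then show ?thesis
    by (simp add: divide_inverse)
qed

section \<open>Expansion of the double bracket over the tuples\<close>

theorem proposition4:
  fixes m l n :: nat
  assumes "n = m + l"
  shows "double_bracket m l =
    (\<Oplus>\<^bsub>refl_tensor m l\<^esub>\<eta>\<in>eta_tuples n.
       refl_scale m l (alpha n \<eta>)
         (perm_op n (refl_series m l) (inv_into UNIV (p_eta n \<eta> 1)) \<otimes>\<^bsub>refl_tensor m l\<^esub>
          ordered_prod (refl_tensor m l) (\<lambda>i. B_op m l (\<eta> i) (of_nat i - 1)) [1..<n + 1]))"
proof -
  \<comment> \<open>Rewriting \<open>{1..n}\<close> to \<open>{Suc 0..n}\<close> would block the ring rules for \<open>refl_tensor m l\<close>.\<close>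
  note One_nat_def [simp del]
  interpret A: ring "reflection_algebra m l"
    by (rule ring_reflection_algebra)
  interpret S: ring "refl_series m l"
    by (rule A.ring_series_ring)
  have fin: "finite (tuples (m + l))"
    by (intro finite_PiE) auto
  interpret T: ring "refl_tensor m l"
    by (rule S.ring_matrix_ring[OF fin])
  define Q where "Q = perm_op n (refl_series m l)"
  define Y where "Y s k = B_op m l s (of_nat k - 1)" for s k :: nat
  define Z where "Z f = refl_scale m l f \<one>\<^bsub>refl_tensor m l\<^esub>" for f
  \<comment> \<open>The factor of \<open>alpha\<close> at index \<open>k\<close>. It is the negative
    of the coefficient in \<open>\<Pi>\<^sub>k\<close>, so the minus sign there becomes a
    plus.\<close>
  define g where "g k = 1 / (of_nat n - 2 * fls_X_inv - 2 + of_nat k :: complex fls)" for k :: nat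
  have Z: "Z f \<in> carrier (refl_tensor m l)" for f
    unfolding Z_def refl_scale_def by (intro S.matrix_scale_closed scalar_series_closed) simp
  have scale: "refl_scale m l f M = Z f \<otimes>\<^bsub>refl_tensor m l\<^esub> M"
    if "M \<in> carrier (refl_tensor m l)" for f M
    unfolding Z_def refl_scale_def
    using S.matrix_scale_one_mult[OF fin scalar_series_closed that] by simp
  have Z_central: "Z f \<otimes>\<^bsub>refl_tensor m l\<^esub> M = M \<otimes>\<^bsub>refl_tensor m l\<^esub> Z f"
    if "M \<in> carrier (refl_tensor m l)" for f M
    unfolding Z_def refl_scale_def
    using S.matrix_scale_one_mult[OF fin scalar_series_closed that]
      S.mult_matrix_scale_one[OF fin scalar_series_closed that scalar_series_central] by simp
  have Z_mult: "Z (f * h) = Z f \<otimes>\<^bsub>refl_tensor m l\<^esub> Z h"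
    if "0 \<le> fls_subdegree f" "0 \<le> fls_subdegree h" for f h
    unfolding scale[OF Z, symmetric] unfolding Z_def refl_scale_def scalar_series_mult[OF that]
    by (intro S.matrix_scale_mult scalar_series_closed) simp
  have Z_one: "Z 1 = \<one>\<^bsub>refl_tensor m l\<^esub>"
    unfolding Z_def refl_scale_def scalar_series_one by (intro S.matrix_scale_one) simp
  \<comment> \<open>The subdegree bound is proved along with the product formula because
    \<open>Z_mult\<close> needs it for the product over the tail.\<close>
  have Z_prod: "0 \<le> fls_subdegree (\<Prod>i\<in>set ks. if P i then g i else 1) \<and>
      ordered_prod (refl_tensor m l) (\<lambda>i. if P i then Z (g i) else \<one>\<^bsub>refl_tensor m l\<^esub>) ks =
      Z (\<Prod>i\<in>set ks. if P i then g i else 1)" if "distinct ks" for ks P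
    using that
  proof (induction ks)
    case (Cons k ks)
    have "0 \<le> fls_subdegree (if P k then g k else 1)"
      unfolding g_def using alpha_factor_subdegree by simp
    with Cons show ?case
      by (auto simp: Z_mult Z_one Z fls_mult_subdegree_ge_0)
  qed (simp add: Z_one)
  have alpha: "ordered_prod (refl_tensor m l)
      (\<lambda>i. if i < \<eta> i then Z (g i) else \<one>\<^bsub>refl_tensor m l\<^esub>) [1..<Suc n] = Z (alpha n \<eta>)" for \<eta>
  proof -
    have "alpha n \<eta> = (\<Prod>i\<in>{1..n}. if i < \<eta> i then g i else 1)"
      unfolding alpha_def g_def by (subst prod.inter_filter) auto
    also have "{1..n} = set [1..<Suc n]"
      by auto
    finally show ?thesis
      using Z_prod[of "[1..<Suc n]" "\<lambda>i. i < \<eta> i"] by (simp del: upt_Suc)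
  qed
  have b: "b_shift m l c \<in> {1..n} \<times> {1..n} \<rightarrow> carrier (refl_series m l)" for c
    using b_shift_closed unfolding assms by blast
  have Q: "Q p \<in> carrier (refl_tensor m l)" for p
    unfolding Q_def assms by (rule S.perm_op_closed)
  have Y: "Y s k \<in> carrier (refl_tensor m l)" if "s \<in> {1..n}" for s k
    unfolding Y_def B_op_def using that b unfolding assms by (rule S.in_position_closed)
  have Y_prod: "ordered_prod (refl_tensor m l) (\<lambda>i. Y (\<eta> i) i) [1..<Suc n] \<in> carrier (refl_tensor m l)"
    if "\<eta> \<in> (\<Pi>\<^sub>E i\<in>{1..n}. {i..n})" for \<eta>
  proof (intro T.ordered_prod_closed Y)
    show "\<eta> i \<in> {1..n}" if "i \<in> set [1..<Suc n]" for i
      using PiE_mem[OF \<open>\<eta> \<in> _\<close>, of i] that by auto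
  qed
  \<comment> \<open>For \<open>k = n\<close> the sum over \<open>{Suc k..n}\<close> is empty and the
    right-hand side is \<one>, so the last factor, which has no \<open>\<Pi>\<^sub>n\<close>, fits
    the same shape as the others.\<close>
  have Pi: "(if k < m + l then Pi_op m l k else \<one>\<^bsub>refl_tensor m l\<^esub>) =
      \<one>\<^bsub>refl_tensor m l\<^esub> \<oplus>\<^bsub>refl_tensor m l\<^esub> Z (g k) \<otimes>\<^bsub>refl_tensor m l\<^esub>
        (\<Oplus>\<^bsub>refl_tensor m l\<^esub>i\<in>{Suc k..n}. Q (Transposition.transpose k i))"
    if k: "k \<in> {1..n}" for k
  proof (cases "k < n")
    case True
    have "2 * fls_X_inv - of_nat k - of_nat (m + l) + 2 =
        - (of_nat n - 2 * fls_X_inv - 2 + of_nat k :: complex fls)"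
      by (simp add: assms)
    then have "inverse (2 * fls_X_inv - of_nat k - of_nat (m + l) + 2 :: complex fls) = - g k"
      unfolding g_def by (simp only: inverse_minus_eq inverse_eq_divide[symmetric])
    moreover have "(\<Oplus>\<^bsub>refl_tensor m l\<^esub>i\<in>{k + 1..m + l}. P_op (m + l) (refl_series m l) k i) =
        (\<Oplus>\<^bsub>refl_tensor m l\<^esub>i\<in>{Suc k..n}. Q (Transposition.transpose k i))"
      using k Q by (intro T.finsum_cong') (auto simp: assms Q_def P_op_eq_perm_op)
    moreover have "refl_scale m l (- f) M = \<ominus>\<^bsub>refl_tensor m l\<^esub> refl_scale m l f M"
      if "M \<in> carrier (refl_tensor m l)" for f M
      unfolding refl_scale_def scalar_series_uminus
      using fin scalar_series_closed that by (rule S.matrix_scale_a_inv)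
    ultimately show ?thesis
      using True Q Z by (simp add: Pi_op_def assms scale T.minus_eq Pi_iff)
  next
    case False
    then show ?thesis
      using Z assms by simp
  qed
  have "double_bracket m l = ordered_prod (refl_tensor m l) (\<lambda>k. Y k k \<otimes>\<^bsub>refl_tensor m l\<^esub>
      (\<one>\<^bsub>refl_tensor m l\<^esub> \<oplus>\<^bsub>refl_tensor m l\<^esub> Z (g k) \<otimes>\<^bsub>refl_tensor m l\<^esub>
        (\<Oplus>\<^bsub>refl_tensor m l\<^esub>i\<in>{Suc k..n}. Q (Transposition.transpose k i)))) [1..<Suc n]"
  proof -
    have "[1..<m + l + 1] = [1..<Suc n]"
      by (simp only: assms Suc_eq_plus1)
    then show ?thesis
      unfolding double_bracket_def Y_def[symmetric]
      by (simp only:) (intro ordered_prod_cong arg_cong2[where f = "(\<otimes>\<^bsub>refl_tensor m l\<^esub>)"] refl Pi; auto)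
  qed
  also have "\<dots> = (\<Oplus>\<^bsub>refl_tensor m l\<^esub>\<eta>\<in>(\<Pi>\<^sub>E i\<in>{1..n}. {i..n}).
      ordered_prod (refl_tensor m l)
        (\<lambda>i. if i < \<eta> i then Z (g i) else \<one>\<^bsub>refl_tensor m l\<^esub>) [1..<Suc n] \<otimes>\<^bsub>refl_tensor m l\<^esub>
      (Q (inv_into UNIV (p_eta n \<eta> 1)) \<otimes>\<^bsub>refl_tensor m l\<^esub>
        ordered_prod (refl_tensor m l) (\<lambda>i. Y (\<eta> i) i) [1..<Suc n]))"
  proof (rule T.ordered_prod_transposition_sums[where Q = Q and Y = Y and c = "\<lambda>k. Z (g k)" and n = n and k = 1])
    show "Q id = \<one>\<^bsub>refl_tensor m l\<^esub>"
      unfolding Q_def assms by (rule S.perm_op_id)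
    show "Q p \<otimes>\<^bsub>refl_tensor m l\<^esub> Q q = Q (p \<circ> q)" if "p permutes {1..n}" "q permutes {1..n}" for p q
      using that unfolding Q_def assms by (rule S.perm_op_mult)
    show "Y s k \<otimes>\<^bsub>refl_tensor m l\<^esub> Q p = Q p \<otimes>\<^bsub>refl_tensor m l\<^esub> Y (inv_into UNIV p s) k"
      if "s \<in> {1..n}" "p permutes {1..n}" for s k p
      using that(2,1) b unfolding Q_def Y_def B_op_def assms by (rule S.in_position_mult_perm_op)
  qed (simp_all add: Q Y Z Z_central)
  also have "\<dots> = (\<Oplus>\<^bsub>refl_tensor m l\<^esub>\<eta>\<in>eta_tuples n.
      refl_scale m l (alpha n \<eta>) (Q (inv_into UNIV (p_eta n \<eta> 1)) \<otimes>\<^bsub>refl_tensor m l\<^esub>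
        ordered_prod (refl_tensor m l) (\<lambda>i. Y (\<eta> i) i) [1..<Suc n]))"
    unfolding eta_tuples_def alpha
  proof (rule T.finsum_cong'[OF refl])
    fix \<eta> assume \<eta>: "\<eta> \<in> (\<Pi>\<^sub>E i\<in>{1..n}. {i..n})"
    show "Z (alpha n \<eta>) \<otimes>\<^bsub>refl_tensor m l\<^esub> (Q (inv_into UNIV (p_eta n \<eta> 1)) \<otimes>\<^bsub>refl_tensor m l\<^esub>
        ordered_prod (refl_tensor m l) (\<lambda>i. Y (\<eta> i) i) [1..<Suc n]) =
      refl_scale m l (alpha n \<eta>) (Q (inv_into UNIV (p_eta n \<eta> 1)) \<otimes>\<^bsub>refl_tensor m l\<^esub>
        ordered_prod (refl_tensor m l) (\<lambda>i. Y (\<eta> i) i) [1..<Suc n])"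
      by (intro scale[symmetric] T.m_closed Q Y_prod \<eta>)
  next
    show "(\<lambda>\<eta>. refl_scale m l (alpha n \<eta>) (Q (inv_into UNIV (p_eta n \<eta> 1)) \<otimes>\<^bsub>refl_tensor m l\<^esub>
        ordered_prod (refl_tensor m l) (\<lambda>i. Y (\<eta> i) i) [1..<Suc n])) \<in>
      (\<Pi>\<^sub>E i\<in>{1..n}. {i..n}) \<rightarrow> carrier (refl_tensor m l)"
      unfolding refl_scale_def
      by (intro Pi_I S.matrix_scale_closed scalar_series_closed T.m_closed Q Y_prod)
  qed
  finally show ?thesis
    unfolding Q_def Y_def Suc_eq_plus1 .
qed

end
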